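(* Let $\mathcal E$ be a sparse toric vector bundle over a smooth toric variety $Y(\Sigma)$ with $n$ rays, with Khovanskii basis $\mathcal B=\{b_1,\dots,b_m\}\subset E$ and diagram $D$ witnessing sparseness (at most one nonzero entry in each row of $D$), where the circuits of $L_{\mathcal B}$ have size at least $3$. Then $\Phi_{\mathcal B}$ has image $\mathcal R(\mathcal E)$ and kernel $\mathcal I_{\mathcal B}=\langle p_1,\dots,p_d\rangle$.
   Context: $\mathbf k$ is algebraically closed, $\Sigma$ a smooth fan with primitive ray generators $\rho_1,\dots,\rho_n$, $\mathcal O_\Sigma$ the semifield of integral piecewise linear functions on $|\Sigma|$ under $\min,+$. A toric vector bundle $\mathcal E$ on $Y(\Sigma)$ with fiber $E$ over the base point of the open orbit corresponds to a valuation $\mathfrak v:\operatorname{Sym}(E)\to\mathcal O_\Sigma$ such that for every $\sigma\in\Sigma$ there is a basis $\mathcal B_\sigma$ of $E$ whose monomials form a vector space basis of $\operatorname{Sym}(E)$ with $\mathfrak v|_\sigma$ of a linear combination equal to the minimum of the values of the monomials occurring, and with $\mathfrak v(b)|_\sigma$ linear and integral for $b\in\mathcal B_\sigma$. $\mathcal B\subset E$ is a Khovanskii basis if for each $\rho\in|\Sigma|$ its classes generate the associated graded algebra of $f\mapsto\mathfrak v(f)(\rho)$. Write $\mathfrak v_i(f)=\mathfrak v(f)(\rho_i)$, $\hat{\mathfrak v}(f)=(\mathfrak v_1(f),\dots,\mathfrak v_n(f))$. $\mathcal R(\mathcal E)=\bigoplus_{\mathbf r\in\mathbb Z^n}\{f\in\operatorname{Sym}(E):\mathfrak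 v_i(f)\ge r_i\ \forall i\}\,t^{\mathbf r}\subset\operatorname{Sym}(E)\otimes\mathbf k[t_1^{\pm1},\dots,t_n^{\pm1}]$ (isomorphic to the Cox ring of $\mathbb P\mathcal E$). $\Phi_{\mathcal B}:\mathbf k[X_1,\dots,X_n,Y_1,\dots,Y_m]\to\operatorname{Sym}(E)\otimes\mathbf k[t^{\pm1}]$ sends $X_i\mapsto t_i^{-1}$, $Y_j\mapsto b_jt^{\hat{\mathfrak v}(b_j)}$; $\mathcal I_{\mathcal B}=\ker\Phi_{\mathcal B}$. The diagram $D$ is the $n\times m$ matrix with entries $\mathfrak v_i(b_j)$; as a standing normalization the minimum entry of each row of $D$ is $0$. $\mathcal E$ is sparse if a Khovanskii basis $\mathcal B\subset E$ can be found such that $D$ has at most one nonzero entry in each row. $L_{\mathcal B}\subset\mathbf k[y_1,\dots,y_m]$ is the linear ideal of relations among the $b_j$, minimally generated by linear forms $\ell_k=\sum_jc_{k,j}y_j$, $1\le k\le d$; circuits of $L_{\mathcal B}$ are its nonzero linear forms of minimal support, and their size is the size of the support. $\alpha_k\in\mathbb Z^n$ is the entrywise minimum of $\hat{\mathfrak v}(b_j)$ over $j$ with $c_{k,j}\neq0$, and $p_k=X^{-\alpha_k}\sum_jc_{k,j}X^{\hat{\mathfrak v}(b_j)}Y_j$. *)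

theory Defs
  imports
    "HOL-Analysis.Analysis"
    "HOL-Library.Poly_Mapping"
    "HOL-Computational_Algebra.Polynomial"
    "HOL-Algebra.Generated_Rings"
    "HOL-Algebra.QuotRing"
begin

section \<open>Smooth fans and piecewise linear functions\<close>

text \<open>
  The lattice of one-parameter subgroups is the standard lattice in \<open>\<real>^'N\<close>. The inner product
  identifies the dual lattice with the same set of vectors.
\<close>

definition lattice :: "(real ^ 'N) set" where
  "lattice = {x. \<forall>i. x $ i \<in> \<int>}"

definition lattice_basis :: "(real ^ 'N) set \<Rightarrow> bool" where
  "lattice_basis B \<longleftrightarrow> finite B \<and> B \<subseteq> lattice \<and> independent B \<and>
     (\<forall>x\<in>lattice. \<exists>a :: real ^ 'N \<Rightarrow> int. x = (\<Sum>b\<in>B. of_int (a b) *\<^sub>R b))"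

definition rational_cone :: "(real ^ 'N) set \<Rightarrow> bool" where
  "rational_cone \<sigma> \<longleftrightarrow> (\<exists>S. finite S \<and> S \<subseteq> lattice \<and> \<sigma> = convex_cone hull S)"

definition strongly_convex :: "(real ^ 'N) set \<Rightarrow> bool" where
  "strongly_convex \<sigma> \<longleftrightarrow> \<sigma> \<inter> uminus ` \<sigma> = {0}"

definition smooth_cone :: "(real ^ 'N) set \<Rightarrow> bool" where
  "smooth_cone \<sigma> \<longleftrightarrow> (\<exists>B S. lattice_basis B \<and> S \<subseteq> B \<and> \<sigma> = convex_cone hull S)"

text \<open>The library's relation \<open>face_of\<close> counts the empty set as a face, which is not a cone.\<close>

definition fan :: "(real ^ 'N) set set \<Rightarrow> bool" where
  "fan \<Sigma> \<longleftrightarrow> finite \<Sigma> \<and> \<Sigma> \<noteq> {} \<and>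
     (\<forall>\<sigma>\<in>\<Sigma>. rational_cone \<sigma> \<and> strongly_convex \<sigma>) \<and>
     (\<forall>\<sigma>\<in>\<Sigma>. \<forall>\<tau>. \<tau> face_of \<sigma> \<and> \<tau> \<noteq> {} \<longrightarrow> \<tau> \<in> \<Sigma>) \<and>
     (\<forall>\<sigma>\<in>\<Sigma>. \<forall>\<tau>\<in>\<Sigma>. \<sigma> \<inter> \<tau> face_of \<sigma> \<and> \<sigma> \<inter> \<tau> face_of \<tau>)"

definition smooth_fan :: "(real ^ 'N) set set \<Rightarrow> bool" where
  "smooth_fan \<Sigma> \<longleftrightarrow> fan \<Sigma> \<and> (\<forall>\<sigma>\<in>\<Sigma>. smooth_cone \<sigma>)"

definition primitive :: "real ^ 'N \<Rightarrow> bool" where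
  "primitive u \<longleftrightarrow> u \<in> lattice \<and> u \<noteq> 0 \<and>
     (\<forall>w\<in>lattice. \<forall>k::nat. u = of_nat k *\<^sub>R w \<longrightarrow> k = 1)"

definition ray_generators :: "(real ^ 'N) set set \<Rightarrow> (real ^ 'N) set" where
  "ray_generators \<Sigma> = {u. primitive u \<and> convex_cone hull {u} \<in> \<Sigma>}"

text \<open>
  The integral piecewise linear functions on the support of \<open>\<Sigma>\<close>. The domains of linearity
  are the cones of some fan with the same support, which need not be \<open>\<Sigma>\<close> (the minimum
  of two functions that are linear on a cone of \<open>\<Sigma>\<close> is in general not linear there).
  Values outside the support are irrelevant. The additive identity of the semifield, the
  constant \<open>\<infinity>\<close>, is not included here.
\<close>

definition pl_functions :: "(real ^ 'N) set set \<Rightarrow> (real ^ 'N \<Rightarrow> ereal) set" where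
  "pl_functions \<Sigma> = {\<phi>. \<exists>\<Delta>. fan \<Delta> \<and> \<Union>\<Delta> = \<Union>\<Sigma> \<and>
     (\<forall>\<tau>\<in>\<Delta>. \<exists>u\<in>lattice. \<forall>x\<in>\<tau>. \<phi> x = ereal (u \<bullet> x))}"


section \<open>Polynomials\<close>

text \<open>
  Multivariate polynomials are elements of the monoid algebra on finitely supported exponents.
\<close>

type_synonym ('x, 'k) mpoly = "('x \<Rightarrow>\<^sub>0 nat) \<Rightarrow>\<^sub>0 'k"

definition Const :: "'k::zero \<Rightarrow> ('x, 'k) mpoly" where
  "Const c = Poly_Mapping.single 0 c"

definition Var :: "'x \<Rightarrow> ('x, 'k::zero_neq_one) mpoly" where
  "Var x = Poly_Mapping.single (Poly_Mapping.single x 1) 1"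

definition vars :: "('x, 'k::zero) mpoly \<Rightarrow> 'x set" where
  "vars f = (\<Union>\<mu>\<in>Poly_Mapping.keys f. Poly_Mapping.keys \<mu>)"

definition mpolys :: "'x set \<Rightarrow> ('x, 'k::zero) mpoly set" where
  "mpolys V = {f. vars f \<subseteq> V}"

definition linear_forms :: "'x set \<Rightarrow> ('x, 'k::zero) mpoly set" where
  "linear_forms V = {f. \<forall>\<mu>\<in>Poly_Mapping.keys f. \<exists>x\<in>V. \<mu> = Poly_Mapping.single x 1}"

definition eval_monom :: "('x \<Rightarrow> 'a::comm_ring_1) \<Rightarrow> ('x \<Rightarrow>\<^sub>0 nat) \<Rightarrow> 'a" where
  "eval_monom s \<mu> = (\<Prod>x\<in>Poly_Mapping.keys \<mu>. s x ^ Poly_Mapping.lookup \<mu> x)"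

definition eval_mpoly ::
    "('k::zero \<Rightarrow> 'a::comm_ring_1) \<Rightarrow> ('x \<Rightarrow> 'a) \<Rightarrow> ('x, 'k) mpoly \<Rightarrow> 'a" where
  "eval_mpoly h s f = (\<Sum>\<mu>\<in>Poly_Mapping.keys f. h (Poly_Mapping.lookup f \<mu>) * eval_monom s \<mu>)"

text \<open>The ideal of \<open>mpolys V\<close> generated by a finite subset \<open>G\<close>.\<close>

definition ideal_gen :: "'x set \<Rightarrow> ('x, 'k::comm_ring_1) mpoly set \<Rightarrow> ('x, 'k) mpoly set" where
  "ideal_gen V G = {\<Sum>g\<in>G. q g * g | q. \<forall>g\<in>G. q g \<in> mpolys V}"


section \<open>Toric vector bundles as valuations\<close>

text \<open>
  Choosing coordinates on the fiber \<open>E\<close>, the symmetric algebra \<open>Sym(E)\<close> is the type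
  \<open>('r, 'k) mpoly\<close> with \<open>'r\<close> finite, and \<open>E\<close> is its subspace of linear forms.
\<close>

abbreviation fiber :: "('r, 'k::zero) mpoly set" where
  "fiber \<equiv> linear_forms UNIV"

definition kscale :: "'k::comm_ring_1 \<Rightarrow> ('r, 'k) mpoly \<Rightarrow> ('r, 'k) mpoly" where
  "kscale c f = Const c * f"

definition family_basis :: "('i \<Rightarrow> ('r, 'k::field) mpoly) \<Rightarrow> ('r, 'k) mpoly set \<Rightarrow> bool" where
  "family_basis \<beta> W \<longleftrightarrow> inj \<beta> \<and> \<not> module.dependent kscale (range \<beta>) \<and>
     module.span kscale (range \<beta>) = W"

definition pl_valuation ::
    "(real ^ 'N) set set \<Rightarrow> (('r, 'k::field) mpoly \<Rightarrow> real ^ 'N \<Rightarrow> ereal) \<Rightarrow> bool" where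
  "pl_valuation \<Sigma> v \<longleftrightarrow>
     (\<forall>x\<in>\<Union>\<Sigma>. v 0 x = \<infinity>) \<and>
     (\<forall>f. f \<noteq> 0 \<longrightarrow> v f \<in> pl_functions \<Sigma>) \<and>
     (\<forall>c. c \<noteq> 0 \<longrightarrow> (\<forall>x\<in>\<Union>\<Sigma>. v (Const c) x = 0)) \<and>
     (\<forall>f g. \<forall>x\<in>\<Union>\<Sigma>. v (f * g) x = v f x + v g x) \<and>
     (\<forall>f g. \<forall>x\<in>\<Union>\<Sigma>. min (v f x) (v g x) \<le> v (f + g) x)"

definition adapted_basis ::
    "(('r::finite, 'k::field) mpoly \<Rightarrow> real ^ 'N \<Rightarrow> ereal) \<Rightarrow> (real ^ 'N) set \<Rightarrow>
     ('r \<Rightarrow> ('r, 'k) mpoly) \<Rightarrow> bool" where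
  "adapted_basis v \<sigma> \<beta> \<longleftrightarrow>
     family_basis \<beta> fiber \<and>
     family_basis (eval_monom \<beta>) UNIV \<and>
     (\<forall>f :: ('r, 'k) mpoly. f \<noteq> 0 \<longrightarrow> (\<forall>x\<in>\<sigma>.
        v (eval_mpoly Const \<beta> f) x = Min ((\<lambda>\<mu>. v (eval_monom \<beta> \<mu>) x) ` Poly_Mapping.keys f))) \<and>
     (\<forall>e. \<exists>u\<in>lattice. \<forall>x\<in>\<sigma>. v (\<beta> e) x = ereal (u \<bullet> x))"

definition toric_vector_bundle ::
    "(real ^ 'N) set set \<Rightarrow> (('r::finite, 'k::field) mpoly \<Rightarrow> real ^ 'N \<Rightarrow> ereal) \<Rightarrow> bool" where
  "toric_vector_bundle \<Sigma> v \<longleftrightarrow> pl_valuation \<Sigma> v \<and> (\<forall>\<sigma>\<in>\<Sigma>. \<exists>\<beta>. adapted_basis v \<sigma> \<beta>)"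


section \<open>Khovanskii bases\<close>

text \<open>
  For a point \<open>x\<close> of the support put \<open>F\<^sub>a = {f. v f x \<ge> a}\<close> and \<open>F\<^sub>>\<^sub>a = {f. v f x > a}\<close>. The
  associated graded algebra, the direct sum over real \<open>a\<close> of the spaces \<open>F\<^sub>a / F\<^sub>>\<^sub>a\<close>, is the
  quotient of the ring of sums of \<open>f s\<^sup>a\<close> with \<open>f \<in> F\<^sub>a\<close> by its ideal of sums of \<open>f s\<^sup>a\<close> with
  \<open>f \<in> F\<^sub>>\<^sub>a\<close>.
\<close>

definition rees_ring ::
    "(('r, 'k::field) mpoly \<Rightarrow> real ^ 'N \<Rightarrow> ereal) \<Rightarrow> real ^ 'N \<Rightarrow> (real \<Rightarrow>\<^sub>0 ('r, 'k) mpoly) ring" where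
  "rees_ring v x = \<lparr>carrier = {F. \<forall>a. ereal a \<le> v (Poly_Mapping.lookup F a) x},
     monoid.mult = (*), one = 1, zero = 0, add = (+)\<rparr>"

definition rees_ideal ::
    "(('r, 'k::field) mpoly \<Rightarrow> real ^ 'N \<Rightarrow> ereal) \<Rightarrow> real ^ 'N \<Rightarrow> (real \<Rightarrow>\<^sub>0 ('r, 'k) mpoly) set" where
  "rees_ideal v x = {F. \<forall>a. ereal a < v (Poly_Mapping.lookup F a) x}"

definition gr_algebra ::
    "(('r, 'k::field) mpoly \<Rightarrow> real ^ 'N \<Rightarrow> ereal) \<Rightarrow> real ^ 'N \<Rightarrow>
     (real \<Rightarrow>\<^sub>0 ('r, 'k) mpoly) set ring" where
  "gr_algebra v x = rees_ring v x Quot rees_ideal v x"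

text \<open>
  The class of \<open>f\<close> sits in degree \<open>v f x\<close>. For \<open>f = 0\<close>, where \<open>v f x = \<infinity>\<close>, the degree
  below is \<open>0\<close> by convention of \<open>real_of_ereal\<close>, and the class is zero, as it should be.
\<close>

definition gr_class ::
    "(('r, 'k::field) mpoly \<Rightarrow> real ^ 'N \<Rightarrow> ereal) \<Rightarrow> real ^ 'N \<Rightarrow> ('r, 'k) mpoly \<Rightarrow>
     (real \<Rightarrow>\<^sub>0 ('r, 'k) mpoly) set" where
  "gr_class v x f =
     rees_ideal v x +>\<^bsub>rees_ring v x\<^esub> Poly_Mapping.single (real_of_ereal (v f x)) f"

text \<open>
  Generation is as an algebra over the ground field, hence the scalars among the ring generators.
\<close>

definition khovanskii_basis ::
    "(real ^ 'N) set set \<Rightarrow> (('r, 'k::field) mpoly \<Rightarrow> real ^ 'N \<Rightarrow> ereal) \<Rightarrow>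
     ('r, 'k) mpoly set \<Rightarrow> bool" where
  "khovanskii_basis \<Sigma> v B \<longleftrightarrow> B \<subseteq> fiber \<and>
     (\<forall>x\<in>\<Union>\<Sigma>. generate_ring (gr_algebra v x) (gr_class v x ` (range Const \<union> B))
        = carrier (gr_algebra v x))"


section \<open>The section ring and its presentation\<close>

text \<open>
  \<open>Sym(E) \<otimes> k[t\<^sub>1\<^sup>\<plusminus>,\<dots>,t\<^sub>n\<^sup>\<plusminus>]\<close> is realised by finitely supported functions from exponents in
  \<open>nat \<Rightarrow>\<^sub>0 int\<close> to \<open>Sym(E)\<close>; only exponents supported on the indices \<open>i < n\<close> occur. Rays, elements
  of the Khovanskii basis and generators of the linear ideal are numbered from \<open>0\<close>.
\<close>

type_synonym ('r, 'k) laurent = "(nat \<Rightarrow>\<^sub>0 int) \<Rightarrow>\<^sub>0 ('r, 'k) mpoly"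

definition section_ring ::
    "(('r, 'k::field) mpoly \<Rightarrow> real ^ 'N \<Rightarrow> ereal) \<Rightarrow> nat \<Rightarrow> (nat \<Rightarrow> real ^ 'N) \<Rightarrow>
     ('r, 'k) laurent set" where
  "section_ring v n \<rho> = {F. \<forall>r\<in>Poly_Mapping.keys F. Poly_Mapping.keys r \<subseteq> {..<n} \<and>
     (\<forall>i<n. ereal (of_int (Poly_Mapping.lookup r i)) \<le> v (Poly_Mapping.lookup F r) (\<rho> i))}"

text \<open>
  The values \<open>v (b j) (\<rho> i)\<close> are integers when \<open>b j \<noteq> 0\<close>; the floor only changes the type.
\<close>

definition diagram ::
    "(('r, 'k::field) mpoly \<Rightarrow> real ^ 'N \<Rightarrow> ereal) \<Rightarrow> (nat \<Rightarrow> real ^ 'N) \<Rightarrow>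
     (nat \<Rightarrow> ('r, 'k) mpoly) \<Rightarrow> nat \<Rightarrow> nat \<Rightarrow> int" where
  "diagram v \<rho> b i j = \<lfloor>real_of_ereal (v (b j) (\<rho> i))\<rfloor>"

definition normalized_diagram :: "nat \<Rightarrow> nat \<Rightarrow> (nat \<Rightarrow> nat \<Rightarrow> int) \<Rightarrow> bool" where
  "normalized_diagram n m D \<longleftrightarrow> (\<forall>i<n. (\<exists>j<m. D i j = 0) \<and> (\<forall>j<m. 0 \<le> D i j))"

definition sparse_diagram :: "nat \<Rightarrow> nat \<Rightarrow> (nat \<Rightarrow> nat \<Rightarrow> int) \<Rightarrow> bool" where
  "sparse_diagram n m D \<longleftrightarrow> (\<forall>i<n. card {j. j < m \<and> D i j \<noteq> 0} \<le> 1)"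

text \<open>The variables \<open>X\<^sub>i\<close> and \<open>Y\<^sub>j\<close> are indexed by \<open>Inl i\<close> and \<open>Inr j\<close>.\<close>

definition XY :: "nat \<Rightarrow> nat \<Rightarrow> (nat + nat) set" where
  "XY n m = {..<n} <+> {..<m}"

definition Phi ::
    "(('r, 'k::field) mpoly \<Rightarrow> real ^ 'N \<Rightarrow> ereal) \<Rightarrow> nat \<Rightarrow> (nat \<Rightarrow> real ^ 'N) \<Rightarrow>
     (nat \<Rightarrow> ('r, 'k) mpoly) \<Rightarrow> (nat + nat, 'k) mpoly \<Rightarrow> ('r, 'k) laurent" where
  "Phi v n \<rho> b = eval_mpoly (\<lambda>c. Poly_Mapping.single 0 (Const c))
     (case_sum
        (\<lambda>i. Poly_Mapping.single (Poly_Mapping.single i (- 1)) 1)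
        (\<lambda>j. Poly_Mapping.single (\<Sum>i<n. Poly_Mapping.single i (diagram v \<rho> b i j)) (b j)))"

definition relation_ideal :: "nat \<Rightarrow> (nat \<Rightarrow> ('r, 'k::field) mpoly) \<Rightarrow> (nat, 'k) mpoly set" where
  "relation_ideal m b = {f \<in> mpolys {..<m}. eval_mpoly Const b f = 0}"

definition circuit :: "nat \<Rightarrow> (nat, 'k::field) mpoly set \<Rightarrow> (nat, 'k) mpoly \<Rightarrow> bool" where
  "circuit m L l \<longleftrightarrow> l \<in> L \<inter> linear_forms {..<m} \<and> l \<noteq> 0 \<and>
     (\<forall>g \<in> L \<inter> linear_forms {..<m}. g \<noteq> 0 \<longrightarrow> \<not> vars g \<subset> vars l)"

definition linear_form :: "nat \<Rightarrow> (nat \<Rightarrow> 'k::field) \<Rightarrow> (nat, 'k) mpoly" where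
  "linear_form m a = (\<Sum>j<m. Const (a j) * Var j)"

definition minimal_generators ::
    "nat \<Rightarrow> (nat, 'k::field) mpoly set \<Rightarrow> nat \<Rightarrow> (nat \<Rightarrow> (nat, 'k) mpoly) \<Rightarrow> bool" where
  "minimal_generators m L d l \<longleftrightarrow> ideal_gen {..<m} (l ` {..<d}) = L \<and>
     (\<forall>k<d. ideal_gen {..<m} (l ` ({..<d} - {k})) \<noteq> L)"

definition min_exponent :: "nat \<Rightarrow> (nat \<Rightarrow> nat \<Rightarrow> int) \<Rightarrow> (nat \<Rightarrow> 'k::zero) \<Rightarrow> nat \<Rightarrow> int" where
  "min_exponent m D a i = Min (D i ` {j. j < m \<and> a j \<noteq> 0})"

text \<open>
  The exponents of the variables \<open>X\<^sub>i\<close> are nonnegative in all terms with \<open>a j \<noteq> 0\<close>; the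
  remaining terms vanish.
\<close>

definition homogenized_form ::
    "nat \<Rightarrow> nat \<Rightarrow> (nat \<Rightarrow> nat \<Rightarrow> int) \<Rightarrow> (nat \<Rightarrow> 'k::field) \<Rightarrow> (nat + nat, 'k) mpoly" where
  "homogenized_form n m D a =
     (\<Sum>j<m. Const (a j) * (\<Prod>i<n. Var (Inl i) ^ nat (D i j - min_exponent m D a i)) * Var (Inr j))"

end

theory Submission
  imports Defs
begin

text \<open>
  Write \<open>v\<^sub>i\<close> for the valuation at the \<open>i\<close>-th ray generator and \<open>D\<close> for the diagram. The point of
  sparseness is that \<open>v\<^sub>i\<close> becomes an order of vanishing. Row \<open>i\<close> of \<open>D\<close> has at most one nonzero
  entry, in column \<open>j\<close> say, and this entry is positive. The Khovanskii property says that every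
  \<open>f\<close> is a polynomial in the \<open>b\<close>'s of weight \<open>v\<^sub>i f\<close>, up to an error of larger value. As every
  monomial of positive weight contains \<open>b\<^sub>j\<close>, repeated subtraction puts every \<open>f\<close> with \<open>v\<^sub>i f > 0\<close>
  into the ideal of \<open>b\<^sub>j\<close> up to errors of arbitrarily large value, and the adapted basis shows that
  these errors are irrelevant: \<open>v\<^sub>i f > 0\<close> forces \<open>b\<^sub>j\<close> to divide \<open>f\<close> (\<open>dvd_of_v_pos\<close>). In a zero
  row the same argument gives \<open>v\<^sub>i f = 0\<close> for all \<open>f \<noteq> 0\<close>. At the origin, where the
  valuation is trivial, the Khovanskii property says that the \<open>b\<close>'s generate \<open>Sym(E)\<close>.

  Both claims follow by the same induction, on the sum of the positive parts of the \<open>r\<^sub>i\<close>.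
  For surjectivity, let \<open>v\<^sub>i f \<ge> r\<^sub>i\<close> for all \<open>i\<close>. If some \<open>r\<^sub>i\<close> is positive and \<open>f \<noteq> 0\<close>, then \<open>f = b\<^sub>j g\<close>, where
  \<open>v\<^sub>i g \<ge> r\<^sub>i - D\<^sub>i\<^sub>j\<close> for all \<open>i\<close>, and one continues with \<open>g\<close>. If no \<open>r\<^sub>i\<close> is positive, every expression of
  \<open>f\<close> through the \<open>b\<close>'s will do. Hence \<open>f\<close> is a combination of monomials \<open>b\<^sup>\<beta>\<close> whose weights are
  at least \<open>r\<close> in every row (\<open>representation_of_bounded_values\<close>), and such a monomial times \<open>t\<^sup>r\<close>
  is an image of \<open>X\<close>'s and \<open>Y\<close>'s.

  For the kernel, an element of degree \<open>r\<close> is the homogenization \<open>\<Sum> c\<^sub>\<beta> X\<^sup>D\<^sup>\<beta>\<^sup>-\<^sup>r Y\<^sup>\<beta>\<close> of a relation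
  \<open>\<Sum> c\<^sub>\<beta> Y\<^sup>\<beta>\<close> of the \<open>b\<close>'s all of whose monomials have weight at least \<open>r\<close>. If some \<open>r\<^sub>i\<close> is positive,
  all these monomials contain the variable \<open>Y\<^sub>j\<close> that belongs to row \<open>i\<close> (in a zero row there are no such
  monomials), and it can be cancelled because \<open>b\<^sub>j \<noteq> 0\<close> and
  \<open>Sym(E)\<close> is a domain. If no \<open>r\<^sub>i\<close> is positive, the homogenization is a monomial in the \<open>X\<close>'s times
  the image of the relation under the ring homomorphism \<open>Y\<^sub>j \<mapsto> X\<^sup>D\<^sup>j Y\<^sub>j\<close> (\<open>twist\<close>), which maps
  the generators \<open>\<ell>\<^sub>k\<close> of the relation ideal to elements of the claimed ideal (\<open>homogenize_relation\<close>).
  In fact it maps \<open>\<ell>\<^sub>k\<close> to \<open>p\<^sub>k\<close>: since circuits have size at least three, the support of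
  \<open>\<ell>\<^sub>k\<close> meets a zero of every row of \<open>D\<close>, so that \<open>\<alpha>\<^sub>k = 0\<close> (\<open>twist_linear_form\<close>).
\<close>

section \<open>Monoid algebras and evaluation\<close>

lemma poly_mapping_sum_single:
  "f = (\<Sum>\<mu>\<in>Poly_Mapping.keys f. Poly_Mapping.single \<mu> (Poly_Mapping.lookup f \<mu>))"
  by (rule poly_mapping_eqI) (auto simp: lookup_sum lookup_single when_def in_keys_iff)

lemma mult_eq_sum_single:
  fixes f g :: "'a::comm_monoid_add \<Rightarrow>\<^sub>0 'b::comm_semiring_1"
  shows "f * g = (\<Sum>a\<in>Poly_Mapping.keys f. \<Sum>b\<in>Poly_Mapping.keys g.
     Poly_Mapping.single (a + b) (Poly_Mapping.lookup f a * Poly_Mapping.lookup g b))"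
proof -
  have "f * g = (\<Sum>a\<in>Poly_Mapping.keys f. Poly_Mapping.single a (Poly_Mapping.lookup f a)) *
      (\<Sum>b\<in>Poly_Mapping.keys g. Poly_Mapping.single b (Poly_Mapping.lookup g b))"
    by (simp flip: poly_mapping_sum_single)
  then show ?thesis
    by (simp add: sum_product mult_single)
qed

lemma sum_mem_closed:
  assumes "0 \<in> A" and "\<And>p q. p \<in> A \<Longrightarrow> q \<in> A \<Longrightarrow> p + q \<in> A" and "\<And>i. i \<in> I \<Longrightarrow> g i \<in> A"
  shows "sum g I \<in> A"
  using assms(3)
proof (induction I rule: infinite_finite_induct)
qed (auto intro: assms(1,2))

text \<open>
  A coefficient of a product is a finite sum of products of coefficients. This is the one fact about
  convolution that is needed to see that the rings below, defined coefficient by coefficient, are closed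
  under multiplication.
\<close>

lemma lookup_mult_closed:
  fixes f g :: "'a::comm_monoid_add \<Rightarrow>\<^sub>0 'b::comm_semiring_1"
  assumes zero: "0 \<in> A" and add: "\<And>p q. p \<in> A \<Longrightarrow> q \<in> A \<Longrightarrow> p + q \<in> A"
    and mult: "\<And>a b. a + b = s \<Longrightarrow> Poly_Mapping.lookup f a * Poly_Mapping.lookup g b \<in> A"
  shows "Poly_Mapping.lookup (f * g) s \<in> A"
  unfolding mult_eq_sum_single[of f g] lookup_sum
  by (intro sum_mem_closed[of A] zero add) (auto simp: lookup_single when_def zero mult)

lemma eval_monom_superset:
  assumes "finite A" and "Poly_Mapping.keys \<mu> \<subseteq> A"
  shows "eval_monom s \<mu> = (\<Prod>x\<in>A. s x ^ Poly_Mapping.lookup \<mu> x)"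
  unfolding eval_monom_def using assms
  by (intro prod.mono_neutral_left) (auto simp: in_keys_iff)

lemma eval_monom_zero [simp]: "eval_monom s 0 = 1"
  by (simp add: eval_monom_def)

lemma eval_monom_plus: "eval_monom s (\<mu> + \<nu>) = eval_monom s \<mu> * eval_monom s \<nu>"
proof -
  let ?A = "Poly_Mapping.keys \<mu> \<union> Poly_Mapping.keys \<nu>"
  have "eval_monom s (\<mu> + \<nu>) = (\<Prod>x\<in>?A. s x ^ Poly_Mapping.lookup (\<mu> + \<nu>) x)"
    by (rule eval_monom_superset) (auto dest: subsetD[OF keys_add])
  also have "\<dots> = (\<Prod>x\<in>?A. s x ^ Poly_Mapping.lookup \<mu> x) * (\<Prod>x\<in>?A. s x ^ Poly_Mapping.lookup \<nu> x)"
    by (simp add: lookup_add power_add prod.distrib)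
  also have "\<dots> = eval_monom s \<mu> * eval_monom s \<nu>"
    by (simp add: eval_monom_superset[of ?A])
  finally show ?thesis .
qed

lemma eval_monom_single: "eval_monom s (Poly_Mapping.single x k) = s x ^ k"
  by (cases "k = 0") (auto simp: eval_monom_def)

lemma eval_monom_sum: "eval_monom s (sum \<mu> I) = (\<Prod>i\<in>I. eval_monom s (\<mu> i))"
  by (induction I rule: infinite_finite_induct) (auto simp: eval_monom_plus)

text \<open>
  The factor \<open>of_nat k\<close> multiplies all values of \<open>\<tau>\<close> by \<open>k\<close>: in the convolution algebra on a
  monoid, natural numbers are multiples of the unit at \<open>0\<close>. This lets exponents with integer
  values be scaled within the same type.
\<close>

lemma single_power:
  "Poly_Mapping.single \<tau> y ^ k = Poly_Mapping.single (of_nat k * \<tau>) (y ^ k)"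
  for \<tau> :: "'a::comm_monoid_add \<Rightarrow>\<^sub>0 'b::comm_semiring_1"
  by (induction k) (auto simp: mult_single algebra_simps)

lemma prod_single:
  fixes \<tau> :: "'i \<Rightarrow> 'a::comm_monoid_add" and y :: "'i \<Rightarrow> 'b::comm_semiring_1"
  shows "(\<Prod>i\<in>I. Poly_Mapping.single (\<tau> i) (y i)) = Poly_Mapping.single (\<Sum>i\<in>I. \<tau> i) (\<Prod>i\<in>I. y i)"
  by (induction I rule: infinite_finite_induct) (auto simp: mult_single)

lemma single_sum: "Poly_Mapping.single a (sum f I) = (\<Sum>i\<in>I. Poly_Mapping.single a (f i))"
  by (induction I rule: infinite_finite_induct) (auto simp: single_add)

lemma lookup_of_nat_mult:
  "Poly_Mapping.lookup (of_nat k * \<tau>) i = of_nat k * Poly_Mapping.lookup \<tau> i"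
  for \<tau> :: "'a::comm_monoid_add \<Rightarrow>\<^sub>0 'b::comm_semiring_1"
  by (induction k) (auto simp: lookup_add algebra_simps)

lemma eval_monom_Var: "eval_monom Var \<mu> = (Poly_Mapping.single \<mu> 1 :: ('x, 'k::comm_ring_1) mpoly)"
proof -
  have "Var x ^ k = (Poly_Mapping.single (Poly_Mapping.single x k) 1 :: ('x, 'k) mpoly)" for x k
    by (induction k) (auto simp: Var_def mult_single simp flip: single_add)
  then show ?thesis
    by (simp add: eval_monom_def prod_single flip: poly_mapping_sum_single)
qed

lemma Const_zero [simp]: "Const 0 = 0"
  by (simp add: Const_def)

lemma Const_one [simp]: "Const 1 = 1"
  by (simp add: Const_def)

lemma lookup_Const_zero [simp]: "Poly_Mapping.lookup (Const a) 0 = a"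
  by (simp add: Const_def)

lemma Const_add: "Const (x + y) = Const x + Const y"
  by (simp add: Const_def single_add)

lemma Const_mult: "Const (x * y) = Const x * Const y"
  by (simp add: Const_def mult_single)

lemma Const_mult_single:
  "Const x * Poly_Mapping.single \<mu> y = Poly_Mapping.single \<mu> (x * y)"
  by (simp add: Const_def mult_single)

lemma lookup_Const_mult:
  "Poly_Mapping.lookup (Const x * f) \<mu> = x * Poly_Mapping.lookup f \<mu>"
  for f :: "('x, 'k::comm_ring_1) mpoly"
  by (simp add: Const_def flip: mult_map_scale_conv_mult) (simp add: map.rep_eq when_def)

lemma uminus_eq_Const_mult: "- f = Const (- 1) * f"
  for f :: "('x, 'k::comm_ring_1) mpoly"
  by (rule poly_mapping_eqI) (simp add: lookup_Const_mult)

text \<open>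
  Evaluation of polynomials is used with two coefficient maps: constants of \<open>Sym(E)\<close>, and constants
  of its Laurent extension. In both cases it is a ring homomorphism.
\<close>

locale coefficient_hom =
  fixes h :: "'k::comm_ring_1 \<Rightarrow> 'a::comm_ring_1"
  assumes h_zero [simp]: "h 0 = 0" and h_one [simp]: "h 1 = 1"
    and h_add: "h (x + y) = h x + h y" and h_mult: "h (x * y) = h x * h y"
begin

lemma eval_mpoly_add: "eval_mpoly h s (f + g) = eval_mpoly h s f + eval_mpoly h s g"
  unfolding eval_mpoly_def
  by (rule setsum_keys_plus_distrib) (auto simp: h_add algebra_simps)

lemma eval_mpoly_zero [simp]: "eval_mpoly h s 0 = 0"
  by (simp add: eval_mpoly_def)

lemma eval_mpoly_sum: "eval_mpoly h s (sum f I) = (\<Sum>i\<in>I. eval_mpoly h s (f i))"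
  by (induction I rule: infinite_finite_induct) (auto simp: eval_mpoly_add)

lemma eval_mpoly_single: "eval_mpoly h s (Poly_Mapping.single \<mu> x) = h x * eval_monom s \<mu>"
  by (cases "x = 0") (auto simp: eval_mpoly_def)

lemma eval_mpoly_Const [simp]: "eval_mpoly h s (Const x) = h x"
  by (simp add: Const_def eval_mpoly_single)

lemma eval_mpoly_Var [simp]: "eval_mpoly h s (Var x) = s x"
  by (simp add: Var_def eval_mpoly_single eval_monom_single)

lemma eval_mpoly_mult: "eval_mpoly h s (f * g) = eval_mpoly h s f * eval_mpoly h s g"
proof -
  have "eval_mpoly h s (f * g) = (\<Sum>a\<in>Poly_Mapping.keys f. \<Sum>b\<in>Poly_Mapping.keys g.
      (h (Poly_Mapping.lookup f a) * eval_monom s a) * (h (Poly_Mapping.lookup g b) * eval_monom s b))"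
    by (subst mult_eq_sum_single) (simp add: eval_mpoly_sum eval_mpoly_single h_mult eval_monom_plus mult_ac)
  then show ?thesis
    by (simp add: eval_mpoly_def sum_product)
qed

end

interpretation Const: coefficient_hom "Const :: 'k::comm_ring_1 \<Rightarrow> ('x, 'k) mpoly"
  by unfold_locales (auto simp: Const_add Const_mult)

interpretation single_Const: coefficient_hom
  "\<lambda>c::'k::comm_ring_1. Poly_Mapping.single (0::nat \<Rightarrow>\<^sub>0 int) (Const c :: ('x, 'k) mpoly)"
  by unfold_locales (auto simp: Const_add Const_mult single_add mult_single)

lemma mpolys_iff: "f \<in> mpolys V \<longleftrightarrow> (\<forall>\<mu>\<in>Poly_Mapping.keys f. Poly_Mapping.keys \<mu> \<subseteq> V)"
  by (auto simp: mpolys_def vars_def)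

lemma mpolys_zero [simp]: "0 \<in> mpolys V"
  by (simp add: mpolys_iff)

lemma mpolys_add: "f \<in> mpolys V \<Longrightarrow> g \<in> mpolys V \<Longrightarrow> f + g \<in> mpolys V"
  unfolding mpolys_iff using keys_add[of f g] by blast

lemma mpolys_sum: "(\<And>i. i \<in> I \<Longrightarrow> f i \<in> mpolys V) \<Longrightarrow> sum f I \<in> mpolys V"
  by (rule sum_mem_closed) (auto intro: mpolys_add)

lemma mpolys_single: "Poly_Mapping.keys \<mu> \<subseteq> V \<Longrightarrow> Poly_Mapping.single \<mu> x \<in> mpolys V"
  by (simp add: mpolys_iff)

lemma mpolys_Const [simp]: "Const x \<in> mpolys V"
  by (simp add: Const_def mpolys_single)

lemma mpolys_one [simp]: "1 \<in> mpolys V"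
  by (simp add: mpolys_iff)

lemma mpolys_Var: "x \<in> V \<Longrightarrow> (Var x :: ('x, 'k::comm_ring_1) mpoly) \<in> mpolys V"
  by (simp add: Var_def mpolys_single)

lemma mpolys_mult:
  assumes "f \<in> mpolys V" and "g \<in> mpolys V"
  shows "f * (g :: ('x, 'k::comm_ring_1) mpoly) \<in> mpolys V"
proof -
  have "Poly_Mapping.keys (a + c) \<subseteq> V"
    if "a \<in> Poly_Mapping.keys f" "c \<in> Poly_Mapping.keys g" for a c
    using that assms keys_add[of a c] unfolding mpolys_iff by blast
  then show ?thesis
    unfolding mpolys_iff using keys_mult[of f g] by blast
qed

lemma mpolys_power: "f \<in> mpolys V \<Longrightarrow> (f :: ('x, 'k::comm_ring_1) mpoly) ^ k \<in> mpolys V"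
  by (induction k) (auto intro: mpolys_mult)

lemma mpolys_prod:
  "(\<And>i. i \<in> I \<Longrightarrow> f i \<in> mpolys V) \<Longrightarrow> (prod f I :: ('x, 'k::comm_ring_1) mpoly) \<in> mpolys V"
  by (induction I rule: infinite_finite_induct) (auto intro: mpolys_mult)

lemma mpolys_eval:
  fixes f :: "('x, 'k::comm_ring_1) mpoly"
  assumes "f \<in> mpolys U" and "\<And>x. x \<in> U \<Longrightarrow> s x \<in> mpolys V"
  shows "eval_mpoly Const s f \<in> mpolys V"
proof -
  have "s x \<in> mpolys V" if "\<mu> \<in> Poly_Mapping.keys f" "x \<in> Poly_Mapping.keys \<mu>" for \<mu> x
    using assms that by (auto simp: mpolys_iff[of f])
  then show ?thesis
    unfolding eval_mpoly_def eval_monom_def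
    by (intro mpolys_sum mpolys_mult mpolys_prod mpolys_power mpolys_Const)
qed

lemma ideal_gen_sum:
  "(\<And>g. g \<in> G \<Longrightarrow> q g \<in> mpolys V) \<Longrightarrow> (\<Sum>g\<in>G. q g * g) \<in> ideal_gen V G"
  unfolding ideal_gen_def by blast

lemma ideal_gen_zero: "0 \<in> ideal_gen V G"
  using ideal_gen_sum[of G "\<lambda>_. 0" V] by simp

lemma ideal_gen_add:
  assumes "f \<in> ideal_gen V G" and "g \<in> ideal_gen V G"
  shows "f + g \<in> ideal_gen V G"
proof -
  obtain p q where "f = (\<Sum>x\<in>G. p x * x)" "\<forall>x\<in>G. p x \<in> mpolys V"
    "g = (\<Sum>x\<in>G. q x * x)" "\<forall>x\<in>G. q x \<in> mpolys V"
    using assms unfolding ideal_gen_def by blast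
  then show ?thesis
    using ideal_gen_sum[of G "\<lambda>x. p x + q x" V]
    by (simp add: mpolys_add sum.distrib distrib_right)
qed

lemma ideal_gen_mult:
  assumes "f \<in> mpolys V" and "g \<in> ideal_gen V G"
  shows "f * g \<in> ideal_gen V G"
proof -
  obtain q where "g = (\<Sum>x\<in>G. q x * x)" "\<forall>x\<in>G. q x \<in> mpolys V"
    using assms(2) unfolding ideal_gen_def by blast
  then show ?thesis
    using ideal_gen_sum[of G "\<lambda>x. f * q x" V] assms(1)
    by (simp add: mpolys_mult sum_distrib_left mult.assoc)
qed

lemma ideal_gen_incl:
  assumes "finite G" and "g \<in> G"
  shows "g \<in> ideal_gen V G"
proof -
  have "(\<Sum>x\<in>G. (if x = g then 1 else 0) * x) = g"
    using assms by (simp add: if_distrib[of "\<lambda>c. c * _"] cong: if_cong)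
  moreover have "(if x = g then 1 else 0) \<in> mpolys V" for x
    by simp
  ultimately show ?thesis
    using ideal_gen_sum[of G "\<lambda>x. if x = g then 1 else 0" V] by simp
qed

section \<open>The associated graded algebra of a valuation at a point\<close>

text \<open>
  A piecewise linear valuation restricted to one point of the support.
\<close>

locale point_valuation =
  fixes v :: "('r::finite, 'k::field) mpoly \<Rightarrow> real ^ 'N \<Rightarrow> ereal" and x :: "real ^ 'N"
  assumes v_zero [simp]: "v 0 x = \<infinity>"
    and v_Const [simp]: "c \<noteq> 0 \<Longrightarrow> v (Const c) x = 0"
    and v_mult: "v (f * g) x = v f x + v g x"
    and v_add: "min (v f x) (v g x) \<le> v (f + g) x"
    and v_finite: "f \<noteq> 0 \<Longrightarrow> \<exists>a. v f x = ereal a"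
begin

lemma v_one [simp]: "v 1 x = 0"
  using v_Const[of 1] by simp

lemma v_uminus [simp]: "v (- f) x = v f x"
  by (simp add: uminus_eq_Const_mult[of f] v_mult)

lemma v_add_ge: "a \<le> v f x \<Longrightarrow> a \<le> v g x \<Longrightarrow> a \<le> v (f + g) x"
  using v_add[of f g] by (meson min.boundedI order_trans)

lemma v_add_greater: "a < v f x \<Longrightarrow> a < v g x \<Longrightarrow> a < v (f + g) x"
  using v_add[of f g] by (meson min_less_iff_conj order_less_le_trans)

lemma v_sum_ge: "(\<And>i. i \<in> I \<Longrightarrow> a \<le> v (f i) x) \<Longrightarrow> a \<le> v (sum f I) x"
  using sum_mem_closed[of "{p. a \<le> v p x}" I f] v_add_ge by simp

lemma v_eval_monom:
  assumes "\<And>e. e \<in> Poly_Mapping.keys \<mu> \<Longrightarrow> v (s e) x = ereal (w e)"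
  shows "v (eval_monom s \<mu>) x = ereal (\<Sum>e\<in>Poly_Mapping.keys \<mu>. real (Poly_Mapping.lookup \<mu> e) * w e)"
proof -
  have power: "v (s e ^ k) x = ereal (real k * w e)" if "e \<in> Poly_Mapping.keys \<mu>" for e k
    by (induction k) (auto simp: v_mult assms[OF that] algebra_simps zero_ereal_def)
  have "v (\<Prod>e\<in>I. s e ^ Poly_Mapping.lookup \<mu> e) x = ereal (\<Sum>e\<in>I. real (Poly_Mapping.lookup \<mu> e) * w e)"
    if "finite I" "I \<subseteq> Poly_Mapping.keys \<mu>" for I
    using that by (induction I rule: finite_induct) (auto simp: v_mult power zero_ereal_def)
  then show ?thesis
    by (simp add: eval_monom_def)
qed

lemma v_eval_monom_ge:
  assumes "\<And>e. e \<in> Poly_Mapping.keys \<mu> \<Longrightarrow> ereal (w e) \<le> v (s e) x"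
  shows "ereal (\<Sum>e\<in>Poly_Mapping.keys \<mu>. real (Poly_Mapping.lookup \<mu> e) * w e) \<le> v (eval_monom s \<mu>) x"
proof -
  have power: "ereal (real k * w e) \<le> v (s e ^ k) x" if "e \<in> Poly_Mapping.keys \<mu>" for e k
  proof (induction k)
    case (Suc k)
    then show ?case
      using add_mono[OF assms[OF that] Suc] by (simp add: v_mult algebra_simps)
  qed (simp add: zero_ereal_def)
  have "ereal (\<Sum>e\<in>I. real (Poly_Mapping.lookup \<mu> e) * w e) \<le> v (\<Prod>e\<in>I. s e ^ Poly_Mapping.lookup \<mu> e) x"
    if "finite I" "I \<subseteq> Poly_Mapping.keys \<mu>" for I
    using that
  proof (induction I rule: finite_induct)
    case (insert e I)
    then show ?case
      using add_mono[OF power[of e "Poly_Mapping.lookup \<mu> e"] insert.IH] by (simp add: v_mult)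
  qed (simp add: zero_ereal_def)
  then show ?thesis
    by (simp add: eval_monom_def)
qed

text \<open>
  Values of nonzero elements are finite, so a valuation witnesses that \<open>Sym(E)\<close> is a domain.
\<close>

lemma mult_eq_zero_iff:
  fixes f g :: "('r, 'k) mpoly"
  shows "f * g = 0 \<longleftrightarrow> f = 0 \<or> g = 0"
proof
  assume eq: "f * g = 0"
  have "v f x + v g x = \<infinity>"
    using v_mult[of f g] eq by simp
  then show "f = 0 \<or> g = 0"
    using v_finite[of f] v_finite[of g] by (cases "f = 0"; cases "g = 0") auto
qed auto

lemma rees_ring_simps [simp]:
  "carrier (rees_ring v x) = {F. \<forall>a. ereal a \<le> v (Poly_Mapping.lookup F a) x}"
  "F \<otimes>\<^bsub>rees_ring v x\<^esub> G = F * G" "F \<oplus>\<^bsub>rees_ring v x\<^esub> G = F + G"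
  "\<one>\<^bsub>rees_ring v x\<^esub> = 1" "\<zero>\<^bsub>rees_ring v x\<^esub> = 0"
  by (auto simp: rees_ring_def)

lemma v_lookup_mult_ge:
  assumes "\<And>a. ereal a \<le> v (Poly_Mapping.lookup F a) x"
    and "\<And>a. ereal a \<le> v (Poly_Mapping.lookup G a) x"
  shows "ereal s \<le> v (Poly_Mapping.lookup (F * G) s) x"
proof -
  have "Poly_Mapping.lookup (F * G) s \<in> {p. ereal s \<le> v p x}"
  proof (rule lookup_mult_closed)
    fix a b assume "a + b = s"
    then show "Poly_Mapping.lookup F a * Poly_Mapping.lookup G b \<in> {p. ereal s \<le> v p x}"
      using add_mono[OF assms(1)[of a] assms(2)[of b]] by (simp add: v_mult)
  qed (auto intro: v_add_ge)
  then show ?thesis by simp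
qed

lemma ereal_add_less_le:
  "ereal a < p \<Longrightarrow> ereal c \<le> q \<Longrightarrow> ereal (a + c) < p + q"
  by (cases p; cases q) auto

lemma v_lookup_mult_greater:
  assumes "\<And>a. ereal a < v (Poly_Mapping.lookup F a) x"
    and "\<And>a. ereal a \<le> v (Poly_Mapping.lookup G a) x"
  shows "ereal s < v (Poly_Mapping.lookup (F * G) s) x"
proof -
  have "Poly_Mapping.lookup (F * G) s \<in> {p. ereal s < v p x}"
  proof (rule lookup_mult_closed)
    fix a b assume "a + b = s"
    then show "Poly_Mapping.lookup F a * Poly_Mapping.lookup G b \<in> {p. ereal s < v p x}"
      using ereal_add_less_le[OF assms(1)[of a] assms(2)[of b]] by (simp add: v_mult)
  qed (auto intro: v_add_greater)
  then show ?thesis by simp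
qed

lemma rees_ring_cring: "cring (rees_ring v x)"
proof (rule cringI)
  show "abelian_group (rees_ring v x)"
  proof (rule abelian_groupI)
    fix F assume "F \<in> carrier (rees_ring v x)"
    then show "\<exists>G\<in>carrier (rees_ring v x). G \<oplus>\<^bsub>rees_ring v x\<^esub> F = \<zero>\<^bsub>rees_ring v x\<^esub>"
      by (intro bexI[of _ "- F"]) auto
  qed (auto simp: lookup_add v_add_ge add_ac)
  show "comm_monoid (rees_ring v x)"
    by (rule comm_monoidI)
      (auto simp: v_lookup_mult_ge lookup_one when_def mult_ac zero_ereal_def[symmetric])
qed (auto simp: distrib_right)

lemma rees_ring_a_inv: "F \<in> carrier (rees_ring v x) \<Longrightarrow> \<ominus>\<^bsub>rees_ring v x\<^esub> F = - F"
proof -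
  interpret cring "rees_ring v x" by (rule rees_ring_cring)
  assume "F \<in> carrier (rees_ring v x)"
  then show ?thesis
    by (intro minus_equality) auto
qed

lemma rees_ideal_ideal: "ideal (rees_ideal v x) (rees_ring v x)"
proof -
  interpret cring "rees_ring v x" by (rule rees_ring_cring)
  show ?thesis
  proof (rule idealI)
    show "subgroup (rees_ideal v x) (add_monoid (rees_ring v x))"
    proof (rule add.subgroupI)
      fix F assume F: "F \<in> rees_ideal v x"
      then have "F \<in> carrier (rees_ring v x)"
        by (auto simp: rees_ideal_def intro: less_imp_le)
      then show "\<ominus>\<^bsub>rees_ring v x\<^esub> F \<in> rees_ideal v x"
        using F by (simp add: rees_ring_a_inv rees_ideal_def)
    next
      have "0 \<in> rees_ideal v x"
        by (simp add: rees_ideal_def)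
      then show "rees_ideal v x \<noteq> {}"
        by blast
    qed (auto simp: rees_ideal_def lookup_add v_add_greater intro: less_imp_le)
  next
    fix F G assume "F \<in> rees_ideal v x" "G \<in> carrier (rees_ring v x)"
    then have "F * G \<in> rees_ideal v x"
      using v_lookup_mult_greater[of F G] by (simp add: rees_ideal_def)
    then show "G \<otimes>\<^bsub>rees_ring v x\<^esub> F \<in> rees_ideal v x" "F \<otimes>\<^bsub>rees_ring v x\<^esub> G \<in> rees_ideal v x"
      by (simp_all add: mult.commute)
  qed (rule ring_axioms)
qed

lemma single_in_rees_ring:
  "Poly_Mapping.single (real_of_ereal (v f x)) f \<in> carrier (rees_ring v x)"
proof (cases "f = 0")
  case False
  then obtain a where "v f x = ereal a"
    using v_finite by blast
  then show ?thesis
    by (auto simp: lookup_single when_def)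
qed simp

text \<open>
  This is how generation of the associated graded algebra is used: it approximates \<open>f\<close>, modulo larger
  values, by a polynomial in \<open>B\<close> that is homogeneous of weight \<open>s\<close>. The family \<open>A\<close> records
  the properties of such polynomials that are of interest; it only has to be closed under the operations by which
  they are built. Indeed, the elements of the Rees ring whose \<open>s\<close>-th coefficient lies in \<open>A s\<close> form a
  subring, and the image of this subring in the quotient contains the generators.
\<close>

lemma leading_part:
  assumes gen: "generate_ring (gr_algebra v x) (gr_class v x ` (range Const \<union> B)) = carrier (gr_algebra v x)"
    and zero: "\<And>s. 0 \<in> A s"
    and add: "\<And>s p q. p \<in> A s \<Longrightarrow> q \<in> A s \<Longrightarrow> p + q \<in> A s"
    and mult: "\<And>s t p q. p \<in> A s \<Longrightarrow> q \<in> A t \<Longrightarrow> p * q \<in> A (s + t)"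
    and Const: "\<And>c. Const c \<in> A 0"
    and B: "\<And>b. b \<in> B \<Longrightarrow> b \<in> A (real_of_ereal (v b x))"
    and f: "ereal s \<le> v f x"
  shows "\<exists>p\<in>A s. ereal s < v (f - p) x"
proof -
  let ?R = "rees_ring v x" and ?I = "rees_ideal v x"
  interpret R: cring ?R by (rule rees_ring_cring)
  interpret I: ideal ?I ?R by (rule rees_ideal_ideal)
  interpret h: ring_hom_ring ?R "?R Quot ?I" "(+>\<^bsub>?R\<^esub>) ?I" by (rule I.rcos_ring_hom_ring)
  define T where "T = {F \<in> carrier ?R. \<forall>a. Poly_Mapping.lookup F a \<in> A a}"
  have Const': "Const c \<in> A (real_of_ereal (v (Const c) x))" for c
    by (cases "c = 0") (use Const[of c] zero in auto)
  have uminus: "- p \<in> A a" if "p \<in> A a" for p a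
    using mult[OF Const[of "- 1"] that] by (simp flip: uminus_eq_Const_mult)
  have T: "subring T ?R"
  proof (rule R.subringI)
    show "T \<subseteq> carrier ?R"
      by (auto simp: T_def)
    show "\<one>\<^bsub>?R\<^esub> \<in> T"
      using R.one_closed Const[of 1] by (auto simp: T_def lookup_one when_def zero)
    fix F assume F: "F \<in> T"
    then have "\<ominus>\<^bsub>?R\<^esub> F = - F"
      by (intro rees_ring_a_inv) (simp add: T_def)
    then show "\<ominus>\<^bsub>?R\<^esub> F \<in> T"
      using F by (auto simp: T_def uminus)
    fix G assume G: "G \<in> T"
    show "F \<oplus>\<^bsub>?R\<^esub> G \<in> T"
      using F G by (auto simp: T_def lookup_add v_add_ge add)
    have "Poly_Mapping.lookup (F * G) a \<in> A a" for a
      by (rule lookup_mult_closed[of "A a"]) (use F G zero add mult in \<open>auto simp: T_def\<close>)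
    then show "F \<otimes>\<^bsub>?R\<^esub> G \<in> T"
      using F G by (auto simp: T_def v_lookup_mult_ge)
  qed
  have gens: "Poly_Mapping.single (real_of_ereal (v g x)) g \<in> T" if "g \<in> range Const \<union> B" for g
  proof -
    have "g \<in> A (real_of_ereal (v g x))"
      using that B Const Const' by auto
    then show ?thesis
      using single_in_rees_ring[of g] by (auto simp: T_def lookup_single when_def zero)
  qed
  have "gr_class v x ` (range Const \<union> B) \<subseteq> (+>\<^bsub>?R\<^esub>) ?I ` T"
    using gens by (auto simp: gr_class_def)
  moreover have "gr_class v x ` (range Const \<union> B) \<subseteq> carrier (?R Quot ?I)"
    using single_in_rees_ring by (auto simp: gr_class_def simp del: rees_ring_simps intro!: h.hom_closed)
  ultimately have "carrier (?R Quot ?I) \<subseteq> (+>\<^bsub>?R\<^esub>) ?I ` T"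
    using h.S.generate_ring_min_subring1 h.img_is_subring[OF T] gen unfolding gr_algebra_def by metis
  moreover have fs: "Poly_Mapping.single s f \<in> carrier ?R"
    using f by (auto simp: lookup_single when_def)
  ultimately obtain F where F: "F \<in> T" "?I +>\<^bsub>?R\<^esub> Poly_Mapping.single s f = ?I +>\<^bsub>?R\<^esub> F"
    using h.hom_closed by blast
  then have "F \<in> carrier ?R"
    by (simp add: T_def)
  with F fs have "Poly_Mapping.single s f \<ominus>\<^bsub>?R\<^esub> F \<in> ?I"
    using I.a_rcos_module_minus[OF R.ring_axioms, of F "Poly_Mapping.single s f"] I.a_rcos_self by metis
  then have "Poly_Mapping.single s f - F \<in> ?I"
    using rees_ring_a_inv[OF \<open>F \<in> carrier ?R\<close>] by (simp add: a_minus_def)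
  then have "ereal s < v (f - Poly_Mapping.lookup F s) x"
    unfolding rees_ideal_def by (auto simp: lookup_minus dest: spec[of _ s])
  then show ?thesis
    using F(1) by (auto simp: T_def)
qed

end

section \<open>Divisibility along a ray\<close>

lemma lookup_mult_zero:
  fixes f g :: "('x, 'k::comm_ring_1) mpoly"
  shows "Poly_Mapping.lookup (f * g) 0 = Poly_Mapping.lookup f 0 * Poly_Mapping.lookup g 0"
proof -
  have zero: "\<mu> + \<nu> = 0 \<longleftrightarrow> \<mu> = 0 \<and> \<nu> = 0" for \<mu> \<nu> :: "'x \<Rightarrow>\<^sub>0 nat"
    by (auto simp: poly_mapping_eq_iff lookup_add fun_eq_iff)
  have "Poly_Mapping.lookup (f * g) 0 = (\<Sum>\<mu>\<in>Poly_Mapping.keys f. \<Sum>\<nu>\<in>Poly_Mapping.keys g.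
      (Poly_Mapping.lookup f \<mu> when \<mu> = 0) * (Poly_Mapping.lookup g \<nu> when \<nu> = 0))"
    unfolding mult_eq_sum_single[of f g] lookup_sum
    by (intro sum.cong refl) (auto simp: lookup_single when_def zero)
  also have "\<dots> = Poly_Mapping.lookup f 0 * Poly_Mapping.lookup g 0"
    by (simp add: sum_product[symmetric] when_def in_keys_iff)
  finally show ?thesis .
qed

text \<open>
  The product rule at the origin, since the coefficient of a variable is a partial derivative there.
\<close>

lemma lookup_mult_linear:
  fixes f g :: "('x, 'k::comm_ring_1) mpoly"
  defines "t y \<equiv> Poly_Mapping.single y 1"
  shows "Poly_Mapping.lookup (f * g) (t y) =
    Poly_Mapping.lookup f 0 * Poly_Mapping.lookup g (t y) + Poly_Mapping.lookup f (t y) * Poly_Mapping.lookup g 0"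
proof -
  have t: "t y \<noteq> 0"
    unfolding t_def by (metis lookup_single_eq lookup_zero one_neq_zero)
  have split: "\<mu> + \<nu> = t y \<longleftrightarrow> \<mu> = 0 \<and> \<nu> = t y \<or> \<mu> = t y \<and> \<nu> = 0" for \<mu> \<nu> :: "'x \<Rightarrow>\<^sub>0 nat"
  proof
    assume eq: "\<mu> + \<nu> = t y"
    have sum: "Poly_Mapping.lookup \<mu> z + Poly_Mapping.lookup \<nu> z = (if z = y then 1 else 0)" for z
      using arg_cong[OF eq, of "\<lambda>\<mu>. Poly_Mapping.lookup \<mu> z"] by (auto simp: lookup_add t_def lookup_single when_def)
    have "\<mu> = 0" if "Poly_Mapping.lookup \<mu> y = 0"
    proof (rule poly_mapping_eqI)
      fix z show "Poly_Mapping.lookup \<mu> z = Poly_Mapping.lookup 0 z"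
        using sum[of z] that by (cases "z = y") auto
    qed
    moreover have "\<nu> = 0" if "Poly_Mapping.lookup \<mu> y \<noteq> 0"
    proof (rule poly_mapping_eqI)
      fix z show "Poly_Mapping.lookup \<nu> z = Poly_Mapping.lookup 0 z"
        using sum[of z] that by (cases "z = y") auto
    qed
    ultimately show "\<mu> = 0 \<and> \<nu> = t y \<or> \<mu> = t y \<and> \<nu> = 0"
      using eq by (cases "Poly_Mapping.lookup \<mu> y = 0") auto
  qed auto
  have "Poly_Mapping.lookup (f * g) (t y) = (\<Sum>\<mu>\<in>Poly_Mapping.keys f. \<Sum>\<nu>\<in>Poly_Mapping.keys g.
      (Poly_Mapping.lookup f \<mu> when \<mu> = 0) * (Poly_Mapping.lookup g \<nu> when \<nu> = t y) +
      (Poly_Mapping.lookup f \<mu> when \<mu> = t y) * (Poly_Mapping.lookup g \<nu> when \<nu> = 0))"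
    unfolding mult_eq_sum_single[of f g] lookup_sum
    by (intro sum.cong refl) (use t in \<open>auto simp: lookup_single when_def split\<close>)
  also have "\<dots> = Poly_Mapping.lookup f 0 * Poly_Mapping.lookup g (t y) +
      Poly_Mapping.lookup f (t y) * Poly_Mapping.lookup g 0"
    by (simp add: sum.distrib sum_product[symmetric] when_def in_keys_iff)
  finally show ?thesis .
qed

lemma fiber_lookup_zero: "f \<in> fiber \<Longrightarrow> Poly_Mapping.lookup f 0 = 0"
proof (rule ccontr)
  assume "f \<in> fiber" "Poly_Mapping.lookup f 0 \<noteq> 0"
  then obtain y :: 'a where "0 = Poly_Mapping.single y (1::nat)"
    unfolding linear_forms_def in_keys_iff[symmetric] by blast
  then show False
    by (metis lookup_single_eq lookup_zero one_neq_zero)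
qed

lemma fiber_eqI:
  assumes "f \<in> fiber" and "g \<in> fiber"
    and "\<And>y. Poly_Mapping.lookup f (Poly_Mapping.single y 1) = Poly_Mapping.lookup g (Poly_Mapping.single y 1)"
  shows "f = g"
proof (rule poly_mapping_eqI)
  fix \<mu>
  show "Poly_Mapping.lookup f \<mu> = Poly_Mapping.lookup g \<mu>"
  proof (cases "\<exists>y. \<mu> = Poly_Mapping.single y 1")
    case True
    then show ?thesis
      using assms(3) by blast
  next
    case False
    then have "\<mu> \<notin> Poly_Mapping.keys f" "\<mu> \<notin> Poly_Mapping.keys g"
      using assms(1,2) unfolding linear_forms_def by blast+
    then show ?thesis
      by (simp add: in_keys_iff)
  qed
qed

lemma fiber_Const_mult: "f \<in> fiber \<Longrightarrow> (Const c * f :: ('x, 'k::comm_ring_1) mpoly) \<in> fiber"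
  by (auto simp: linear_forms_def in_keys_iff lookup_Const_mult)

lemma split_exponent:
  assumes "e \<in> Poly_Mapping.keys \<mu>"
  shows "\<mu> = Poly_Mapping.single e (1::nat) + (\<mu> - Poly_Mapping.single e 1)"
proof (rule poly_mapping_eqI)
  fix y
  have "0 < Poly_Mapping.lookup \<mu> e"
    using assms by (simp add: in_keys_iff)
  then show "Poly_Mapping.lookup \<mu> y = Poly_Mapping.lookup (Poly_Mapping.single e 1 + (\<mu> - Poly_Mapping.single e 1)) y"
    by (auto simp: lookup_add lookup_minus lookup_single when_def)
qed

lemma eval_monom_split:
  "e \<in> Poly_Mapping.keys \<mu> \<Longrightarrow> eval_monom s \<mu> = s e * eval_monom s (\<mu> - Poly_Mapping.single e 1)"
  using arg_cong[OF split_exponent[of e \<mu>], of "eval_monom s"] by (simp add: eval_monom_plus eval_monom_single)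

lemma eval_monom_constant_coeff:
  assumes "\<And>e. s e \<in> fiber" and "\<mu> \<noteq> 0"
  shows "Poly_Mapping.lookup (eval_monom s \<mu>) 0 = 0"
proof -
  obtain e where "e \<in> Poly_Mapping.keys \<mu>"
    using assms(2) by (metis ex_in_conv keys_eq_empty)
  then show ?thesis
    by (simp add: eval_monom_split[of e \<mu>] lookup_mult_zero fiber_lookup_zero assms(1))
qed

text \<open>
  Splitting off one factor leaves a monomial without constant term, and the split factor has none either.
\<close>

lemma eval_monom_linear_coeff:
  assumes "\<And>e. s e \<in> fiber" and "\<mu> \<noteq> 0" and "\<And>e. \<mu> \<noteq> Poly_Mapping.single e 1"
  shows "Poly_Mapping.lookup (eval_monom s \<mu>) (Poly_Mapping.single y 1) = 0"
proof -
  obtain e where e: "e \<in> Poly_Mapping.keys \<mu>"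
    using assms(2) by (metis ex_in_conv keys_eq_empty)
  then have "\<mu> - Poly_Mapping.single e 1 \<noteq> 0"
    using split_exponent[OF e] assms(3)[of e] by auto
  then show ?thesis
    unfolding eval_monom_split[OF e] lookup_mult_linear
    by (simp add: fiber_lookup_zero eval_monom_constant_coeff assms(1))
qed

lemma module_kscale: "Modules.module (kscale :: 'k::comm_ring_1 \<Rightarrow> ('r, 'k) mpoly \<Rightarrow> _)"
  by unfold_locales (auto simp: kscale_def Const_add Const_mult algebra_simps)

lemma adapted_basis_fiber: "adapted_basis v \<sigma> \<beta> \<Longrightarrow> \<beta> e \<in> fiber"
  using module.span_base[OF module_kscale, of "\<beta> e" "range \<beta>"]
  by (auto simp: adapted_basis_def family_basis_def)

text \<open>
  The monomials in an adapted basis span \<open>Sym(E)\<close>, and the polynomials in the basis form a subspace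
  that contains them.
\<close>

lemma adapted_basis_surj:
  assumes "adapted_basis v \<sigma> \<beta>"
  obtains P where "f = eval_mpoly Const \<beta> P"
proof -
  have "module.subspace kscale (range (eval_mpoly Const \<beta>))"
  proof (rule module.subspaceI[OF module_kscale])
    show "0 \<in> range (eval_mpoly Const \<beta>)"
      using Const.eval_mpoly_zero by (metis rangeI)
    fix f g assume fg: "f \<in> range (eval_mpoly Const \<beta>)" "g \<in> range (eval_mpoly Const \<beta>)"
    then show "f + g \<in> range (eval_mpoly Const \<beta>)"
      by (auto simp flip: Const.eval_mpoly_add)
    show "kscale c f \<in> range (eval_mpoly Const \<beta>)" for c
      using fg Const.eval_mpoly_mult[of \<beta> "Const c"] by (auto simp: kscale_def) (metis rangeI)
  qed
  moreover have "range (eval_monom \<beta>) \<subseteq> range (eval_mpoly Const \<beta>)"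
    using Const.eval_mpoly_single[of \<beta> _ 1] by (auto simp: image_iff) metis
  ultimately have "module.span kscale (range (eval_monom \<beta>)) \<subseteq> range (eval_mpoly Const \<beta>)"
    by (intro module.span_minimal[OF module_kscale])
  then have "f \<in> range (eval_mpoly Const \<beta>)"
    using assms by (auto simp: adapted_basis_def family_basis_def)
  then show ?thesis
    using that by blast
qed

context point_valuation
begin

text \<open>
  Here sparseness enters, as the condition that one linear form \<open>q\<close> divides all elements of \<open>B\<close> of
  positive value. Taking leading parts repeatedly, every \<open>f\<close> of positive value is
  a multiple of \<open>q\<close> up to an error of value as large as desired. If this is a member
  \<open>\<beta> e\<close> of the adapted basis, choose the error of value larger than all values of basis elements. Then only monomials of degree at least two occur in it, and
  comparison of linear parts makes \<open>\<beta> e\<close> itself a scalar multiple of \<open>q\<close>. Finally, the value of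
  a combination of basis monomials is the minimum of their values, so an element of positive
  value has in each of its basis monomials a factor of positive value, hence a factor \<open>q\<close>.
  
  The form \<open>q\<close> may be zero; then no nonzero element has positive value.
\<close>

lemma ray_divisor:
  assumes gen: "generate_ring (gr_algebra v x) (gr_class v x ` (range Const \<union> B)) = carrier (gr_algebra v x)"
    and \<beta>: "adapted_basis v \<sigma> \<beta>" "x \<in> \<sigma>"
    and int: "\<And>f. f \<noteq> 0 \<Longrightarrow> \<exists>a. v f x = ereal (of_int a)"
    and q: "q \<in> fiber"
    and B: "\<And>b. b \<in> B \<Longrightarrow> 0 \<le> v b x" "\<And>b. b \<in> B \<Longrightarrow> 0 < v b x \<Longrightarrow> q dvd b"
  shows v_nonneg: "0 \<le> v f x" and dvd_of_v_pos: "0 < v f x \<Longrightarrow> q dvd f"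
proof -
  \<comment> \<open>A polynomial in \<open>B\<close> that is homogeneous of weight \<open>s\<close> vanishes for \<open>s < 0\<close> and is divisible by \<open>q\<close> for \<open>s > 0\<close>.\<close>
  define A where "A s = {p. (s < 0 \<longrightarrow> p = 0) \<and> (0 < s \<longrightarrow> q dvd p)}" for s :: real
  have lead: "\<exists>p\<in>A s. ereal s < v (f - p) x" if f: "ereal s \<le> v f x" for f s
  proof (rule leading_part[OF gen _ _ _ _ _ f])
    fix s t p r assume "p \<in> A s" "r \<in> A t"
    moreover have "s + t < 0 \<Longrightarrow> s < 0 \<or> t < 0" "0 < s + t \<Longrightarrow> 0 < s \<or> 0 < t"
      by linarith+
    ultimately show "p * r \<in> A (s + t)"
      unfolding A_def by (auto intro: dvd_mult dvd_mult2)
  next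
    fix b assume b: "b \<in> B"
    have "\<not> real_of_ereal (v b x) < 0"
      using B(1)[OF b] by (simp add: real_of_ereal_pos not_less)
    moreover have "0 < v b x" if "0 < real_of_ereal (v b x)"
      using that B(1)[OF b] by (cases "v b x = 0") auto
    ultimately show "b \<in> A (real_of_ereal (v b x))"
      using B(2)[OF b] by (auto simp: A_def)
  qed (auto simp: A_def)
  have nonneg: "0 \<le> v f x" for f
  proof (cases "f = 0")
    case False
    then obtain a where a: "v f x = ereal a"
      using v_finite by blast
    show ?thesis
    proof (rule ccontr)
      assume "\<not> 0 \<le> v f x"
      then show False
        using lead[of a f] a by (auto simp: A_def)
    qed
  qed simp
  then show "0 \<le> v f x" .
  \<comment> \<open>Values at \<open>x\<close> are integers, so each subtraction of a leading part raises the value of the error by at least one.\<close>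
  have approx: "\<exists>g h. f = q * g + h \<and> ereal (real M) < v h x" if f: "0 < v f x" for f and M :: nat
  proof (induction M)
    case 0
    have "f = q * 0 + f"
      by simp
    then show ?case
      using f by (metis of_nat_0 zero_ereal_def)
  next
    case (Suc M)
    then obtain g h where gh: "f = q * g + h" "ereal (real M) < v h x"
      by blast
    show ?case
    proof (cases "h = 0")
      case True
      then show ?thesis
        using gh(1) by (intro exI[of _ g] exI[of _ 0]) auto
    next
      case False
      then obtain a where a: "v h x = ereal (of_int a)"
        using int by blast
      then have "int M < a"
        using gh(2) by simp
      then have aM: "real (Suc M) \<le> of_int a"
        by linarith
      obtain p where p: "p \<in> A (of_int a)" "ereal (of_int a) < v (h - p) x"
        using lead[of "of_int a" h] a by auto
      then obtain g' where g': "p = q * g'"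
        using aM by (auto simp: A_def)
      have "ereal (real (Suc M)) \<le> ereal (of_int a)"
        using aM by simp
      then have "ereal (real (Suc M)) < v (h - p) x"
        using p(2) by (rule le_less_trans)
      moreover have "f = q * (g + g') + (h - p)"
        using gh(1) g' by (simp add: algebra_simps)
      ultimately show ?thesis
        by blast
    qed
  qed
  obtain u where u: "\<And>e. v (\<beta> e) x = ereal (u e \<bullet> x)"
    using \<beta> unfolding adapted_basis_def by metis
  define w where "w e = u e \<bullet> x" for e
  have w: "v (\<beta> e) x = ereal (w e)" for e
    by (simp add: u w_def)
  have vM: "v (eval_monom \<beta> \<mu>) x = ereal (\<Sum>e\<in>Poly_Mapping.keys \<mu>. real (Poly_Mapping.lookup \<mu> e) * w e)" for \<mu>
    by (rule v_eval_monom) (rule w)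
  have v_le: "v (eval_mpoly Const \<beta> P) x \<le> v (eval_monom \<beta> \<mu>) x"
    if "\<mu> \<in> Poly_Mapping.keys P" for P \<mu>
  proof -
    have "P \<noteq> 0"
      using that by auto
    then have "v (eval_mpoly Const \<beta> P) x = Min ((\<lambda>\<mu>. v (eval_monom \<beta> \<mu>) x) ` Poly_Mapping.keys P)"
      using \<beta> unfolding adapted_basis_def by blast
    then show ?thesis
      using that by simp
  qed
  have basis_dvd: "q dvd \<beta> e" if "0 < w e" for e
  proof -
    \<comment> \<open>The bound on the value of the error that rules out linear monomials.\<close>
    obtain M where M: "Max (range w) \<le> real M"
      using real_arch_simple by blast
    have "\<exists>g h. \<beta> e = q * g + h \<and> ereal (real M) < v h x"
      using approx[of "\<beta> e" M] that w by simp
    then obtain g h where gh: "\<beta> e = q * g + h" "ereal (real M) < v h x"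
      by blast
    obtain H where H: "h = eval_mpoly Const \<beta> H"
      using adapted_basis_surj[OF \<beta>(1)] by metis
    have linear: "Poly_Mapping.lookup (eval_monom \<beta> \<mu>) (Poly_Mapping.single y 1) = 0"
      if \<mu>: "\<mu> \<in> Poly_Mapping.keys H" for \<mu> y
    proof (rule eval_monom_linear_coeff)
      have gt: "ereal (real M) < v (eval_monom \<beta> \<mu>) x"
        using gh(2) v_le[OF \<mu>] H by simp
      show "\<mu> \<noteq> 0"
        using gt by auto
      show "\<mu> \<noteq> Poly_Mapping.single e' 1" for e'
      proof
        assume "\<mu> = Poly_Mapping.single e' 1"
        then have "real M < w e'"
          using gt by (simp add: eval_monom_single w)
        moreover have "w e' \<le> Max (range w)"
          by (rule Max_ge) auto
        ultimately show False
          using M by linarith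
      qed
    qed (rule adapted_basis_fiber[OF \<beta>(1)])
    have "Poly_Mapping.lookup h (Poly_Mapping.single y 1) = 0" for y
      unfolding H eval_mpoly_def lookup_sum lookup_Const_mult using linear by (intro sum.neutral) simp
    then have "\<beta> e = Const (Poly_Mapping.lookup g 0) * q"
      by (intro fiber_eqI adapted_basis_fiber[OF \<beta>(1)] fiber_Const_mult q)
        (simp add: gh(1) lookup_add lookup_mult_linear[unfolded One_nat_def] lookup_Const_mult fiber_lookup_zero q)
    then show ?thesis
      by simp
  qed
  show "q dvd f" if f: "0 < v f x"
  proof -
    obtain P where P: "f = eval_mpoly Const \<beta> P"
      using adapted_basis_surj[OF \<beta>(1)] by metis
    have "q dvd eval_monom \<beta> \<mu>" if \<mu>: "\<mu> \<in> Poly_Mapping.keys P" for \<mu>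
    proof -
      have "0 < v (eval_monom \<beta> \<mu>) x"
        using f v_le[OF \<mu>] P by simp
      then have "0 < (\<Sum>e\<in>Poly_Mapping.keys \<mu>. real (Poly_Mapping.lookup \<mu> e) * w e)"
        by (simp add: vM)
      then obtain e where e: "e \<in> Poly_Mapping.keys \<mu>" "0 < real (Poly_Mapping.lookup \<mu> e) * w e"
        by (meson not_le sum_nonpos)
      then have "q dvd \<beta> e"
        by (intro basis_dvd) (auto simp: zero_less_mult_iff)
      then show ?thesis
        using e(1) by (simp add: eval_monom_split[of e \<mu>])
    qed
    then show ?thesis
      unfolding P eval_mpoly_def by (intro dvd_sum dvd_mult)
  qed
qed

end

section \<open>The grading of the presentation\<close>

text \<open>
  The exponent of \<open>t\<^sub>i\<close> in the image of \<open>Y\<^sup>\<beta>\<close>.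
\<close>

definition weight :: "(nat \<Rightarrow> nat \<Rightarrow> int) \<Rightarrow> (nat \<Rightarrow>\<^sub>0 nat) \<Rightarrow> nat \<Rightarrow> int" where
  "weight D \<beta> i = (\<Sum>j\<in>Poly_Mapping.keys \<beta>. int (Poly_Mapping.lookup \<beta> j) * D i j)"

lemma weight_superset:
  assumes "finite A" and "Poly_Mapping.keys \<beta> \<subseteq> A"
  shows "weight D \<beta> i = (\<Sum>j\<in>A. int (Poly_Mapping.lookup \<beta> j) * D i j)"
  unfolding weight_def using assms by (intro sum.mono_neutral_left) (auto simp: in_keys_iff)

lemma weight_plus: "weight D (\<beta> + \<gamma>) i = weight D \<beta> i + weight D \<gamma> i"
  unfolding weight_def by (rule setsum_keys_plus_distrib) (auto simp: algebra_simps)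

lemma weight_single: "weight D (Poly_Mapping.single j k) i = int k * D i j"
  by (cases "k = 0") (auto simp: weight_def)

lemma weight_pos_factor:
  assumes "0 < weight D \<beta> i"
  obtains j where "j \<in> Poly_Mapping.keys \<beta>" and "D i j \<noteq> 0"
  using assms unfolding weight_def by (metis (no_types, lifting) mult_zero_right less_irrefl sum.neutral)

definition y_part :: "(nat + nat \<Rightarrow>\<^sub>0 nat) \<Rightarrow> (nat \<Rightarrow>\<^sub>0 nat)" where
  "y_part = Poly_Mapping.map_key Inr"

lemma lookup_y_part [simp]: "Poly_Mapping.lookup (y_part \<mu>) j = Poly_Mapping.lookup \<mu> (Inr j)"
  by (simp add: y_part_def map_key.rep_eq)

lemma keys_y_part: "Poly_Mapping.keys \<mu> \<subseteq> XY n m \<Longrightarrow> Poly_Mapping.keys (y_part \<mu>) \<subseteq> {..<m}"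
  by (auto simp: in_keys_iff XY_def dest!: subsetD)

definition total_degree :: "nat \<Rightarrow> (nat \<Rightarrow> nat \<Rightarrow> int) \<Rightarrow> (nat + nat \<Rightarrow>\<^sub>0 nat) \<Rightarrow> (nat \<Rightarrow>\<^sub>0 int)" where
  "total_degree n D \<mu> = (\<Sum>x\<in>Poly_Mapping.keys \<mu>. of_nat (Poly_Mapping.lookup \<mu> x) *
     (case x of Inl i \<Rightarrow> Poly_Mapping.single i (- 1) | Inr j \<Rightarrow> \<Sum>i<n. Poly_Mapping.single i (D i j)))"

lemma lookup_total_degree:
  assumes "Poly_Mapping.keys \<mu> \<subseteq> XY n m"
  shows "Poly_Mapping.lookup (total_degree n D \<mu>) i =
    (if i < n then weight D (y_part \<mu>) i - int (Poly_Mapping.lookup \<mu> (Inl i)) else 0)"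
proof -
  have "Poly_Mapping.lookup (total_degree n D \<mu>) i = (\<Sum>x\<in>XY n m. int (Poly_Mapping.lookup \<mu> x) *
      Poly_Mapping.lookup (case x of Inl i \<Rightarrow> Poly_Mapping.single i (- 1)
        | Inr j \<Rightarrow> \<Sum>i<n. Poly_Mapping.single i (D i j)) i)"
    unfolding total_degree_def lookup_sum lookup_of_nat_mult
    using assms by (intro sum.mono_neutral_left) (auto simp: XY_def in_keys_iff)
  also have "\<dots> = (\<Sum>i'<n. int (Poly_Mapping.lookup \<mu> (Inl i')) * (- 1 when i' = i)) +
      (\<Sum>j<m. int (Poly_Mapping.lookup \<mu> (Inr j)) * (\<Sum>i'<n. D i' j when i' = i))"
    by (simp add: XY_def sum.Plus lookup_sum lookup_single)
  also have "\<dots> = (if i < n then weight D (y_part \<mu>) i - int (Poly_Mapping.lookup \<mu> (Inl i)) else 0)"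
    using weight_superset[OF _ keys_y_part[OF assms], of D i] by (auto simp: when_def if_distrib cong: if_cong)
  finally show ?thesis .
qed

text \<open>
  The map \<open>Phi\<close> with an arbitrary integer matrix in place of the diagram: the multigrading depends on
  the matrix only.
\<close>

definition presentation :: "nat \<Rightarrow> (nat \<Rightarrow> nat \<Rightarrow> int) \<Rightarrow> (nat \<Rightarrow> ('r, 'k::field) mpoly) \<Rightarrow>
    (nat + nat, 'k) mpoly \<Rightarrow> ('r, 'k) laurent" where
  "presentation n D b = eval_mpoly (\<lambda>c. Poly_Mapping.single 0 (Const c))
     (case_sum (\<lambda>i. Poly_Mapping.single (Poly_Mapping.single i (- 1)) 1)
       (\<lambda>j. Poly_Mapping.single (\<Sum>i<n. Poly_Mapping.single i (D i j)) (b j)))"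

lemma Phi_eq_presentation: "Phi v n \<rho> b = presentation n (diagram v \<rho> b) b"
  by (simp add: Phi_def presentation_def)

lemma presentation_single:
  assumes "Poly_Mapping.keys \<mu> \<subseteq> XY n m"
  shows "presentation n D b (Poly_Mapping.single \<mu> a) =
    Poly_Mapping.single (total_degree n D \<mu>) (Const a * eval_monom b (y_part \<mu>))"
proof -
  let ?y = "case_sum (\<lambda>_. 1) b"
  have fin: "finite (XY n m)"
    by (simp add: XY_def)
  have subst: "case_sum (\<lambda>i. Poly_Mapping.single (Poly_Mapping.single i (- 1)) 1)
       (\<lambda>j. Poly_Mapping.single (\<Sum>i<n. Poly_Mapping.single i (D i j)) (b j)) =
     (\<lambda>x. Poly_Mapping.single (case x of Inl i \<Rightarrow> Poly_Mapping.single i (- 1)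
        | Inr j \<Rightarrow> \<Sum>i<n. Poly_Mapping.single i (D i j)) (?y x))"
    by (auto split: sum.split)
  have "eval_monom ?y \<mu> = (\<Prod>x\<in>XY n m. ?y x ^ Poly_Mapping.lookup \<mu> x)"
    by (rule eval_monom_superset[OF fin assms])
  also have "\<dots> = (\<Prod>j<m. b j ^ Poly_Mapping.lookup \<mu> (Inr j))"
    by (simp add: XY_def prod.Plus)
  also have "\<dots> = eval_monom b (y_part \<mu>)"
    using eval_monom_superset[OF _ keys_y_part[OF assms], of b] by simp
  finally have "eval_monom ?y \<mu> = eval_monom b (y_part \<mu>)" .
  moreover have "presentation n D b (Poly_Mapping.single \<mu> a) =
      Poly_Mapping.single (total_degree n D \<mu>) (Const a * eval_monom ?y \<mu>)"
    unfolding presentation_def single_Const.eval_mpoly_single subst eval_monom_def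
      single_power prod_single total_degree_def
    by (simp add: mult_single)
  ultimately show ?thesis
    by simp
qed

lemma presentation_expand:
  assumes "F \<in> mpolys (XY n m)"
  shows "presentation n D b F = (\<Sum>\<mu>\<in>Poly_Mapping.keys F.
    Poly_Mapping.single (total_degree n D \<mu>) (Const (Poly_Mapping.lookup F \<mu>) * eval_monom b (y_part \<mu>)))"
proof -
  have "presentation n D b F =
      presentation n D b (\<Sum>\<mu>\<in>Poly_Mapping.keys F. Poly_Mapping.single \<mu> (Poly_Mapping.lookup F \<mu>))"
    by (simp flip: poly_mapping_sum_single)
  also have "\<dots> = (\<Sum>\<mu>\<in>Poly_Mapping.keys F. presentation n D b (Poly_Mapping.single \<mu> (Poly_Mapping.lookup F \<mu>)))"
    unfolding presentation_def by (rule single_Const.eval_mpoly_sum)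
  also have "\<dots> = (\<Sum>\<mu>\<in>Poly_Mapping.keys F.
      Poly_Mapping.single (total_degree n D \<mu>) (Const (Poly_Mapping.lookup F \<mu>) * eval_monom b (y_part \<mu>)))"
    using assms by (intro sum.cong refl presentation_single) (auto simp: mpolys_iff)
  finally show ?thesis .
qed

text \<open>
  The exponent of the unique monomial in \<open>X\<close> and \<open>Y\<close> of degree \<open>r\<close> whose \<open>Y\<close>-part is \<open>\<beta>\<close>. It exists
  if the weight of \<open>\<beta>\<close> is at least \<open>r\<close> in every row; otherwise the truncation to natural numbers makes this a
  default value.
\<close>

definition hom_exponent :: "nat \<Rightarrow> (nat \<Rightarrow> nat \<Rightarrow> int) \<Rightarrow> (nat \<Rightarrow> int) \<Rightarrow> (nat \<Rightarrow>\<^sub>0 nat) \<Rightarrow> (nat + nat \<Rightarrow>\<^sub>0 nat)" where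
  "hom_exponent n D r \<beta> = (\<Sum>i<n. Poly_Mapping.single (Inl i) (nat (weight D \<beta> i - r i))) +
     (\<Sum>j\<in>Poly_Mapping.keys \<beta>. Poly_Mapping.single (Inr j) (Poly_Mapping.lookup \<beta> j))"

lemma lookup_hom_exponent [simp]:
  "Poly_Mapping.lookup (hom_exponent n D r \<beta>) (Inl i) = (if i < n then nat (weight D \<beta> i - r i) else 0)"
  "Poly_Mapping.lookup (hom_exponent n D r \<beta>) (Inr j) = Poly_Mapping.lookup \<beta> j"
  by (auto simp: hom_exponent_def lookup_add lookup_sum lookup_single when_def in_keys_iff)

lemma keys_hom_exponent:
  assumes "Poly_Mapping.keys \<beta> \<subseteq> {..<m}"
  shows "Poly_Mapping.keys (hom_exponent n D r \<beta>) \<subseteq> XY n m"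
proof
  fix x assume "x \<in> Poly_Mapping.keys (hom_exponent n D r \<beta>)"
  then show "x \<in> XY n m"
    using assms by (cases x) (auto simp: in_keys_iff XY_def split: if_splits dest!: subsetD)
qed

lemma y_part_hom_exponent [simp]: "y_part (hom_exponent n D r \<beta>) = \<beta>"
  by (rule poly_mapping_eqI) simp

lemma hom_exponent_y_part:
  assumes "Poly_Mapping.keys \<mu> \<subseteq> XY n m"
  shows "hom_exponent n D (Poly_Mapping.lookup (total_degree n D \<mu>)) (y_part \<mu>) = \<mu>"
proof (rule poly_mapping_eqI)
  fix x
  show "Poly_Mapping.lookup (hom_exponent n D (Poly_Mapping.lookup (total_degree n D \<mu>)) (y_part \<mu>)) x =
      Poly_Mapping.lookup \<mu> x"
  proof (cases x)
    case (Inl i)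
    have "Poly_Mapping.lookup \<mu> (Inl i) = 0" if "\<not> i < n"
      using assms that by (auto simp: in_keys_iff XY_def)
    then show ?thesis
      by (simp add: Inl lookup_total_degree[OF assms])
  qed simp
qed

definition homogenize :: "nat \<Rightarrow> (nat \<Rightarrow> nat \<Rightarrow> int) \<Rightarrow> (nat \<Rightarrow> int) \<Rightarrow> (nat, 'k::field) mpoly \<Rightarrow>
    (nat + nat, 'k) mpoly" where
  "homogenize n D r g =
     (\<Sum>\<beta>\<in>Poly_Mapping.keys g. Poly_Mapping.single (hom_exponent n D r \<beta>) (Poly_Mapping.lookup g \<beta>))"

lemma homogenize_zero [simp]: "homogenize n D r 0 = 0"
  by (simp add: homogenize_def)

lemma homogenize_add: "homogenize n D r (f + g) = homogenize n D r f + homogenize n D r g"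
  unfolding homogenize_def by (rule setsum_keys_plus_distrib) (auto simp: single_add)

lemma homogenize_sum: "homogenize n D r (sum f I) = (\<Sum>i\<in>I. homogenize n D r (f i))"
  by (induction I rule: infinite_finite_induct) (auto simp: homogenize_add)

lemma homogenize_single:
  "homogenize n D r (Poly_Mapping.single \<beta> a) = Poly_Mapping.single (hom_exponent n D r \<beta>) a"
  by (cases "a = 0") (auto simp: homogenize_def)

lemma homogenize_mpolys: "g \<in> mpolys {..<m} \<Longrightarrow> homogenize n D r g \<in> mpolys (XY n m)"
  unfolding homogenize_def by (intro mpolys_sum mpolys_single keys_hom_exponent) (auto simp: mpolys_iff)

lemma presentation_homogenize:
  assumes g: "g \<in> mpolys {..<m}" and r: "Poly_Mapping.keys r \<subseteq> {..<n}"
    and le: "\<And>\<beta> i. \<beta> \<in> Poly_Mapping.keys g \<Longrightarrow> i < n \<Longrightarrow> Poly_Mapping.lookup r i \<le> weight D \<beta> i"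
  shows "presentation n D b (homogenize n D (Poly_Mapping.lookup r) g) =
    Poly_Mapping.single r (eval_mpoly Const b g)"
proof -
  let ?E = "hom_exponent n D (Poly_Mapping.lookup r)"
  have mono: "presentation n D b (Poly_Mapping.single (?E \<beta>) a) =
      Poly_Mapping.single r (Const a * eval_monom b \<beta>)"
    if \<beta>: "\<beta> \<in> Poly_Mapping.keys g" for \<beta> a
  proof -
    have keys: "Poly_Mapping.keys (?E \<beta>) \<subseteq> XY n m"
      using g \<beta> by (intro keys_hom_exponent) (auto simp: mpolys_iff)
    have "total_degree n D (?E \<beta>) = r"
    proof (rule poly_mapping_eqI)
      fix i
      have "Poly_Mapping.lookup r i = 0" if "\<not> i < n"
        using r that by (auto simp: in_keys_iff)
      then show "Poly_Mapping.lookup (total_degree n D (?E \<beta>)) i = Poly_Mapping.lookup r i"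
        using le[OF \<beta>, of i] by (simp add: lookup_total_degree[OF keys])
    qed
    then show ?thesis
      by (simp add: presentation_single[OF keys])
  qed
  have "presentation n D b (homogenize n D (Poly_Mapping.lookup r) g) =
     (\<Sum>\<beta>\<in>Poly_Mapping.keys g. presentation n D b (Poly_Mapping.single (?E \<beta>) (Poly_Mapping.lookup g \<beta>)))"
    unfolding homogenize_def presentation_def by (rule single_Const.eval_mpoly_sum)
  also have "\<dots> = Poly_Mapping.single r (eval_mpoly Const b g)"
    by (simp add: mono eval_mpoly_def single_sum)
  finally show ?thesis .
qed

text \<open>
  For a nonnegative matrix this is homogenization in degree \<open>0\<close>, in a form that is visibly multiplicative.
\<close>

definition twist :: "nat \<Rightarrow> (nat \<Rightarrow> nat \<Rightarrow> int) \<Rightarrow> (nat, 'k::field) mpoly \<Rightarrow> (nat + nat, 'k) mpoly" where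
  "twist n D = eval_mpoly Const (\<lambda>j. (\<Prod>i<n. Var (Inl i) ^ nat (D i j)) * Var (Inr j))"

lemma twist_mpolys: "g \<in> mpolys {..<m} \<Longrightarrow> twist n D g \<in> mpolys (XY n m)"
  unfolding twist_def
  by (rule mpolys_eval) (auto intro!: mpolys_mult mpolys_prod mpolys_power mpolys_Var simp: XY_def)

lemma eval_monom_hom_exponent:
  "eval_monom s (hom_exponent n D r \<beta>) =
    (\<Prod>i<n. s (Inl i) ^ nat (weight D \<beta> i - r i)) * eval_monom (\<lambda>j. s (Inr j)) \<beta>"
  by (simp add: hom_exponent_def eval_monom_plus eval_monom_sum eval_monom_single)
    (simp add: eval_monom_def)

text \<open>
  In a degree without positive entries no exponent is truncated, because weights are nonnegative, and so
  homogenization differs from a ring homomorphism only by the monomial \<open>X\<^sup>-\<^sup>r\<close>.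
\<close>

lemma homogenize_nonpos:
  assumes D: "\<And>i j. i < n \<Longrightarrow> j < m \<Longrightarrow> 0 \<le> D i j" and g: "g \<in> mpolys {..<m}"
    and r: "\<And>i. i < n \<Longrightarrow> r i \<le> 0"
  shows "homogenize n D r g = (\<Prod>i<n. Var (Inl i) ^ nat (- r i)) * twist n D g"
proof -
  let ?X = "\<lambda>i. Var (Inl i) :: (nat + nat, 'a) mpoly" and ?Y = "\<lambda>j. Var (Inr j) :: (nat + nat, 'a) mpoly"
  let ?\<eta> = "\<lambda>j. (\<Prod>i<n. ?X i ^ nat (D i j)) * ?Y j"
  have mono: "Poly_Mapping.single (hom_exponent n D r \<beta>) a =
      (\<Prod>i<n. ?X i ^ nat (- r i)) * (Const a * eval_monom ?\<eta> \<beta>)"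
    if "\<beta> \<in> Poly_Mapping.keys g" for \<beta> a
  proof -
    have keys: "j < m" if "j \<in> Poly_Mapping.keys \<beta>" for j
      using g \<open>\<beta> \<in> _\<close> that by (auto simp: mpolys_iff)
    have nonneg: "0 \<le> weight D \<beta> i" if "i < n" for i
      unfolding weight_def using D that keys by (intro sum_nonneg mult_nonneg_nonneg) auto
    have nat_weight: "nat (weight D \<beta> i) = (\<Sum>j\<in>Poly_Mapping.keys \<beta>. nat (D i j) * Poly_Mapping.lookup \<beta> j)"
      if "i < n" for i
    proof -
      have "weight D \<beta> i = int (\<Sum>j\<in>Poly_Mapping.keys \<beta>. nat (D i j) * Poly_Mapping.lookup \<beta> j)"
        unfolding weight_def of_nat_sum using D[OF that] keys by (intro sum.cong) (auto simp: mult.commute)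
      then show ?thesis by (simp only: nat_int)
    qed
    have "eval_monom ?\<eta> \<beta> = (\<Prod>j\<in>Poly_Mapping.keys \<beta>. \<Prod>i<n. ?X i ^ (nat (D i j) * Poly_Mapping.lookup \<beta> j)) *
        eval_monom ?Y \<beta>"
      by (simp add: eval_monom_def power_mult_distrib prod.distrib prod_power_distrib power_mult)
    also have "(\<Prod>j\<in>Poly_Mapping.keys \<beta>. \<Prod>i<n. ?X i ^ (nat (D i j) * Poly_Mapping.lookup \<beta> j)) =
        (\<Prod>i<n. ?X i ^ nat (weight D \<beta> i))"
      by (subst prod.swap) (simp add: nat_weight power_sum)
    finally have \<eta>: "eval_monom ?\<eta> \<beta> = (\<Prod>i<n. ?X i ^ nat (weight D \<beta> i)) * eval_monom ?Y \<beta>" .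
    have "(\<Prod>i<n. ?X i ^ nat (weight D \<beta> i - r i)) =
        (\<Prod>i<n. ?X i ^ nat (- r i)) * (\<Prod>i<n. ?X i ^ nat (weight D \<beta> i))"
      unfolding prod.distrib[symmetric] power_add[symmetric]
      using nonneg r by (intro prod.cong refl arg_cong[of _ _ "(^) _"]) (simp flip: nat_add_distrib)
    moreover have "Poly_Mapping.single (hom_exponent n D r \<beta>) a = Const a * eval_monom Var (hom_exponent n D r \<beta>)"
      by (simp add: eval_monom_Var Const_mult_single)
    ultimately show ?thesis
      unfolding \<eta> eval_monom_hom_exponent by (simp only: mult_ac)
  qed
  show ?thesis
    unfolding homogenize_def twist_def eval_mpoly_def sum_distrib_left
    by (intro sum.cong refl) (rule mono)
qed

section \<open>Dividing out a row of the diagram\<close>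

lemma sum_nat_less:
  fixes r r' :: "nat \<Rightarrow> int"
  assumes "i < n" and "0 < r i" and "r' i < r i" and "\<And>i. i < n \<Longrightarrow> r' i \<le> r i"
  shows "(\<Sum>i<n. nat (r' i)) < (\<Sum>i<n. nat (r i))"
  using assms by (intro sum_strict_mono_ex1) (auto intro!: bexI[of _ i] nat_mono)

locale sparse_matrix =
  fixes n m :: nat and D :: "nat \<Rightarrow> nat \<Rightarrow> int"
  assumes D_nonneg: "i < n \<Longrightarrow> j < m \<Longrightarrow> 0 \<le> D i j"
    and sparse: "i < n \<Longrightarrow> j < m \<Longrightarrow> j' < m \<Longrightarrow> D i j \<noteq> 0 \<Longrightarrow> D i j' \<noteq> 0 \<Longrightarrow> j = j'"
begin

lemma weight_nonneg:
  assumes "i < n" and "Poly_Mapping.keys \<beta> \<subseteq> {..<m}"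
  shows "0 \<le> weight D \<beta> i"
  unfolding weight_def using assms D_nonneg by (intro sum_nonneg mult_nonneg_nonneg) auto

text \<open>
  Induction on the sum of the positive parts of \<open>r\<close>. If \<open>r i > 0\<close> for some \<open>i\<close>, then \<open>f\<close> has positive value at
  \<open>\<rho> i\<close>, and \<open>f = b j * g\<close>. Additivity of the valuations at all rays passes the bounds on to \<open>g\<close>, lowered by column
  \<open>j\<close> of the matrix.
\<close>

lemma representation_of_bounded_values:
  fixes v :: "('r::finite, 'k::field) mpoly \<Rightarrow> real ^ 'N \<Rightarrow> ereal"
  assumes val: "\<And>i. i < n \<Longrightarrow> point_valuation v (\<rho> i)"
    and generate: "\<And>f. \<exists>P\<in>mpolys {..<m}. f = eval_mpoly Const b P"
    and v_b: "\<And>i j. i < n \<Longrightarrow> j < m \<Longrightarrow> b j \<noteq> 0 \<Longrightarrow> v (b j) (\<rho> i) = ereal (of_int (D i j))"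
    and divisor: "\<And>i f. i < n \<Longrightarrow> 0 < v f (\<rho> i) \<Longrightarrow> f \<noteq> 0 \<Longrightarrow> \<exists>j<m. D i j \<noteq> 0 \<and> b j dvd f"
    and f: "\<And>i. i < n \<Longrightarrow> ereal (of_int (r i)) \<le> v f (\<rho> i)"
  shows "\<exists>P\<in>mpolys {..<m}. f = eval_mpoly Const b P \<and>
    (\<forall>\<beta>\<in>Poly_Mapping.keys P. \<forall>i<n. r i \<le> weight D \<beta> i)"
  using f
proof (induction "\<Sum>i<n. nat (r i)" arbitrary: r f rule: less_induct)
  case less
  show ?case
  proof (cases "f = 0")
    case True
    then show ?thesis
      by (intro bexI[of _ 0]) auto
  next
    case f: False
    show ?thesis
    proof (cases "\<forall>i<n. r i \<le> 0")
      case True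
      obtain P where "P \<in> mpolys {..<m}" "f = eval_mpoly Const b P"
        using generate by blast
      moreover have "r i \<le> weight D \<beta> i" if "\<beta> \<in> Poly_Mapping.keys P" "i < n" for \<beta> i
        using True weight_nonneg[of i \<beta>] calculation(1) that by (force simp: mpolys_iff)
      ultimately show ?thesis
        by blast
    next
      case False
      then obtain i where i: "i < n" "0 < r i"
        by force
      have "0 < ereal (of_int (r i))"
        using i(2) by simp
      then have "0 < v f (\<rho> i)"
        using less.prems[OF i(1)] by (rule less_le_trans)
      then obtain j g where j: "j < m" "D i j \<noteq> 0" and g: "f = b j * g"
        using divisor[OF i(1) _ f] by (auto elim: dvdE)
      have bj: "b j \<noteq> 0"
        using f g by auto
      have le: "ereal (of_int (r i' - D i' j)) \<le> v g (\<rho> i')" if i': "i' < n" for i'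
      proof -
        interpret point_valuation v "\<rho> i'" by (rule val[OF i'])
        show ?thesis
          using less.prems[OF i'] v_b[OF i' j(1) bj]
          by (cases "v g (\<rho> i')") (auto simp: g v_mult)
      qed
      have "(\<Sum>i'<n. nat (r i' - D i' j)) < (\<Sum>i'<n. nat (r i'))"
        using i j D_nonneg[OF _ j(1)] by (intro sum_nat_less[of i]) (auto simp: order_less_le)
      then obtain P where P: "P \<in> mpolys {..<m}" "g = eval_mpoly Const b P"
        "\<And>\<beta> i'. \<beta> \<in> Poly_Mapping.keys P \<Longrightarrow> i' < n \<Longrightarrow> r i' - D i' j \<le> weight D \<beta> i'"
        using less.hyps[OF _ le] by blast
      have "r i' \<le> weight D \<beta> i'" if \<beta>: "\<beta> \<in> Poly_Mapping.keys (Var j * P)" and i': "i' < n" for \<beta> i'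
      proof -
        obtain \<gamma> where "\<beta> = Poly_Mapping.single j 1 + \<gamma>" "\<gamma> \<in> Poly_Mapping.keys P"
          using subsetD[OF keys_mult \<beta>] by (auto simp: Var_def split: if_splits)
        then show ?thesis
          using P(3)[of \<gamma> i'] i' by (simp add: weight_plus weight_single)
      qed
      then show ?thesis
        using P(1,2) g j(1) by (intro bexI[of _ "Var j * P"]) (auto simp: Const.eval_mpoly_mult intro: mpolys_mult mpolys_Var)
    qed
  qed
qed

text \<open>
  The same induction for relations. If \<open>r i > 0\<close>, every monomial of \<open>g\<close> has positive weight in row \<open>i\<close>, and
  therefore contains the variable of the only column that contributes to this row. Cancelling that variable from \<open>g\<close> leaves a relation,
  and on homogenizations it splits off the factor \<open>Y\<^sub>j\<close>, when \<open>r\<close> is lowered by column \<open>j\<close>.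
\<close>

lemma homogenize_relation:
  fixes b :: "nat \<Rightarrow> ('r, 'k::field) mpoly"
  assumes twist: "\<And>g. g \<in> relation_ideal m b \<Longrightarrow> twist n D g \<in> ideal_gen (XY n m) G"
    and domain: "\<And>f g :: ('r, 'k) mpoly. f * g = 0 \<Longrightarrow> f = 0 \<or> g = 0"
    and b: "\<And>i j. i < n \<Longrightarrow> j < m \<Longrightarrow> D i j \<noteq> 0 \<Longrightarrow> b j \<noteq> 0"
    and g: "g \<in> relation_ideal m b"
    and le: "\<And>\<beta> i. \<beta> \<in> Poly_Mapping.keys g \<Longrightarrow> i < n \<Longrightarrow> r i \<le> weight D \<beta> i"
  shows "homogenize n D r g \<in> ideal_gen (XY n m) G"
  using g le
proof (induction "\<Sum>i<n. nat (r i)" arbitrary: r g rule: less_induct)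
  case less
  have g: "g \<in> mpolys {..<m}" "eval_mpoly Const b g = 0"
    using less.prems(1) by (auto simp: relation_ideal_def)
  have keys: "Poly_Mapping.keys \<beta> \<subseteq> {..<m}" if "\<beta> \<in> Poly_Mapping.keys g" for \<beta>
    using g(1) that by (simp add: mpolys_iff)
  show ?case
  proof (cases "\<forall>i<n. r i \<le> 0")
    case True
    have "(\<Prod>i<n. Var (Inl i) ^ nat (- r i) :: (nat + nat, 'k) mpoly) \<in> mpolys (XY n m)"
      by (auto intro!: mpolys_prod mpolys_power mpolys_Var simp: XY_def)
    then show ?thesis
      using True homogenize_nonpos[of n m D g r, OF D_nonneg g(1)] twist[OF less.prems(1)]
      by (simp add: ideal_gen_mult)
  next
    case False
    then obtain i where i: "i < n" "0 < r i"
      by force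
    have factor: "\<exists>j\<in>Poly_Mapping.keys \<beta>. j < m \<and> D i j \<noteq> 0" if "\<beta> \<in> Poly_Mapping.keys g" for \<beta>
    proof -
      have "0 < weight D \<beta> i"
        using less.prems(2)[OF that i(1)] i(2) by simp
      then show ?thesis
        using keys[OF that] by (elim weight_pos_factor) auto
    qed
    show ?thesis
    proof (cases "g = 0")
      case True
      then show ?thesis
        by (simp add: ideal_gen_zero)
    next
      case False
      then obtain \<beta>0 where "\<beta>0 \<in> Poly_Mapping.keys g"
        by (metis ex_in_conv keys_eq_empty)
      then obtain j where j: "j < m" "D i j \<noteq> 0"
        using factor by blast
      have mem: "j \<in> Poly_Mapping.keys \<beta>" if "\<beta> \<in> Poly_Mapping.keys g" for \<beta>
        using factor[OF that] sparse[OF i(1) j(1) _ j(2)] by auto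
      let ?e = "Poly_Mapping.single j (1::nat)"
      define g' where "g' = (\<Sum>\<beta>\<in>Poly_Mapping.keys g. Poly_Mapping.single (\<beta> - ?e) (Poly_Mapping.lookup g \<beta>))"
      define r' where "r' = (\<lambda>i. r i - D i j)"
      have "Var j * g' = (\<Sum>\<beta>\<in>Poly_Mapping.keys g. Poly_Mapping.single \<beta> (Poly_Mapping.lookup g \<beta>))"
        unfolding g'_def sum_distrib_left Var_def mult_single
        by (intro sum.cong refl) (simp only: mult_1_left split_exponent[OF mem, symmetric])
      then have gg': "g = Var j * g'"
        by (simp flip: poly_mapping_sum_single)
      have keys_diff: "Poly_Mapping.keys (\<beta> - ?e) \<subseteq> Poly_Mapping.keys \<beta>" for \<beta>
        by (auto simp: in_keys_iff lookup_minus)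
      have "g' \<in> mpolys {..<m}"
        unfolding g'_def using keys keys_diff by (intro mpolys_sum mpolys_single) blast
      moreover have "eval_mpoly Const b g' = 0"
        using g(2) domain[of "b j" "eval_mpoly Const b g'"] b[OF i(1) j] by (simp add: gg' Const.eval_mpoly_mult)
      ultimately have g'_rel: "g' \<in> relation_ideal m b"
        by (simp add: relation_ideal_def)
      have le: "r' i' \<le> weight D \<gamma> i'" if \<gamma>: "\<gamma> \<in> Poly_Mapping.keys g'" and i': "i' < n" for \<gamma> i'
      proof -
        obtain \<beta> where \<beta>: "\<beta> \<in> Poly_Mapping.keys g" "\<gamma> = \<beta> - ?e"
          using \<gamma> keys_sum[of "\<lambda>\<beta>. Poly_Mapping.single (\<beta> - ?e) (Poly_Mapping.lookup g \<beta>)" "Poly_Mapping.keys g"]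
          unfolding g'_def by (auto split: if_splits)
        have "weight D \<beta> i' = D i' j + weight D \<gamma> i'"
          using arg_cong[OF split_exponent[OF mem[OF \<beta>(1)]], of "\<lambda>\<beta>. weight D \<beta> i'"] \<beta>(2)
          by (simp add: weight_plus weight_single)
        then show ?thesis
          using less.prems(2)[OF \<beta>(1) i'] by (simp add: r'_def)
      qed
      have "(\<Sum>i'<n. nat (r' i')) < (\<Sum>i'<n. nat (r i'))"
        unfolding r'_def using i j D_nonneg[OF _ j(1)] by (intro sum_nat_less[of i]) (auto simp: order_less_le)
      then have IH: "homogenize n D r' g' \<in> ideal_gen (XY n m) G"
        using less.hyps[OF _ g'_rel le] by blast
      have exponent: "hom_exponent n D r \<beta> = Poly_Mapping.single (Inr j) 1 + hom_exponent n D r' (\<beta> - ?e)"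
        if \<beta>: "\<beta> \<in> Poly_Mapping.keys g" for \<beta>
      proof -
        define \<gamma> where "\<gamma> = \<beta> - ?e"
        have \<beta>\<gamma>: "\<beta> = ?e + \<gamma>"
          unfolding \<gamma>_def by (rule split_exponent[OF mem[OF \<beta>]])
        have "hom_exponent n D r (?e + \<gamma>) = Poly_Mapping.single (Inr j) 1 + hom_exponent n D r' \<gamma>"
        proof (rule poly_mapping_eqI)
          fix x
          show "Poly_Mapping.lookup (hom_exponent n D r (?e + \<gamma>)) x =
              Poly_Mapping.lookup (Poly_Mapping.single (Inr j) 1 + hom_exponent n D r' \<gamma>) x"
            by (cases x) (auto simp: lookup_add lookup_single when_def weight_plus weight_single r'_def algebra_simps)
        qed
        then show ?thesis
          unfolding \<beta>\<gamma>[symmetric] by (simp only: \<gamma>_def)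
      qed
      have "homogenize n D r g = Var (Inr j) * homogenize n D r' g'"
        unfolding g'_def homogenize_sum homogenize_single sum_distrib_left Var_def mult_single
        by (simp add: homogenize_def exponent cong: sum.cong)
      moreover have "Inr j \<in> XY n m"
        using j(1) by (auto simp: XY_def)
      ultimately show ?thesis
        using IH by (simp add: ideal_gen_mult mpolys_Var)
    qed
  qed
qed

text \<open>
  The kernel is homogeneous, and its components are homogenizations: the \<open>X\<close>-part of a monomial is determined by
  its degree and its \<open>Y\<close>-part, so a component of degree \<open>r\<close> can be recovered from the polynomial \<open>g r\<close> obtained by
  setting all \<open>X\<close> to \<open>1\<close>, and \<open>g r\<close> is a relation.
\<close>

lemma kernel_subset_ideal:
  fixes b :: "nat \<Rightarrow> ('r, 'k::field) mpoly"
  assumes rel: "\<And>g r. g \<in> relation_ideal m b \<Longrightarrow>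
      (\<And>\<beta> i. \<beta> \<in> Poly_Mapping.keys g \<Longrightarrow> i < n \<Longrightarrow> r i \<le> weight D \<beta> i) \<Longrightarrow>
      homogenize n D r g \<in> ideal_gen (XY n m) G"
    and F: "F \<in> mpolys (XY n m)" and ker: "presentation n D b F = 0"
  shows "F \<in> ideal_gen (XY n m) G"
proof -
  let ?deg = "total_degree n D" and ?K = "Poly_Mapping.keys F"
  define g where "g r = (\<Sum>\<mu>\<in>{\<mu>\<in>?K. ?deg \<mu> = r}. Poly_Mapping.single (y_part \<mu>) (Poly_Mapping.lookup F \<mu>))" for r
  have keys: "Poly_Mapping.keys \<mu> \<subseteq> XY n m" if "\<mu> \<in> ?K" for \<mu>
    using F that by (simp add: mpolys_iff)
  have "F = (\<Sum>\<mu>\<in>?K. Poly_Mapping.single \<mu> (Poly_Mapping.lookup F \<mu>))"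
    by (rule poly_mapping_sum_single)
  also have "\<dots> = (\<Sum>r\<in>?deg ` ?K. \<Sum>\<mu>\<in>{\<mu>\<in>?K. ?deg \<mu> = r}. Poly_Mapping.single \<mu> (Poly_Mapping.lookup F \<mu>))"
    by (rule sum.image_gen) simp
  also have "\<dots> = (\<Sum>r\<in>?deg ` ?K. homogenize n D (Poly_Mapping.lookup r) (g r))"
    unfolding g_def homogenize_sum homogenize_single
    by (intro sum.cong refl) (auto simp: hom_exponent_y_part[OF keys])
  finally have decomposition: "F = (\<Sum>r\<in>?deg ` ?K. homogenize n D (Poly_Mapping.lookup r) (g r))" .
  have "homogenize n D (Poly_Mapping.lookup r) (g r) \<in> ideal_gen (XY n m) G" for r
  proof (rule rel)
    have "eval_mpoly Const b (g r) = (\<Sum>\<mu>\<in>{\<mu>\<in>?K. ?deg \<mu> = r}. Const (Poly_Mapping.lookup F \<mu>) * eval_monom b (y_part \<mu>))"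
      unfolding g_def Const.eval_mpoly_sum Const.eval_mpoly_single ..
    also have "\<dots> = Poly_Mapping.lookup (presentation n D b F) r"
      unfolding presentation_expand[OF F] lookup_sum lookup_single
      by (simp add: when_def sum.inter_filter)
    finally have "eval_mpoly Const b (g r) = 0"
      using ker by simp
    moreover have "g r \<in> mpolys {..<m}"
      unfolding g_def using keys by (intro mpolys_sum mpolys_single keys_y_part) auto
    ultimately show "g r \<in> relation_ideal m b"
      by (simp add: relation_ideal_def)
  next
    fix \<beta> i assume \<beta>: "\<beta> \<in> Poly_Mapping.keys (g r)" and i: "i < n"
    obtain \<mu> where \<mu>: "\<mu> \<in> ?K" "?deg \<mu> = r" "\<beta> = y_part \<mu>"
      using \<beta> keys_sum[of "\<lambda>\<mu>. Poly_Mapping.single (y_part \<mu>) (Poly_Mapping.lookup F \<mu>)" "{\<mu>\<in>?K. ?deg \<mu> = r}"]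
      unfolding g_def by (auto split: if_splits)
    then show "Poly_Mapping.lookup r i \<le> weight D \<beta> i"
      using lookup_total_degree[OF keys[OF \<mu>(1)], of D i] i by simp
  qed
  then show ?thesis
    by (subst decomposition) (intro sum_mem_closed ideal_gen_zero ideal_gen_add)
qed

end

section \<open>Linear relations\<close>

lemma linear_form_eq_sum_single:
  "linear_form m a = (\<Sum>j<m. Poly_Mapping.single (Poly_Mapping.single j 1) (a j))"
  by (simp add: linear_form_def Var_def Const_mult_single)

lemma keys_linear_form:
  "Poly_Mapping.keys (linear_form m a) \<subseteq> (\<lambda>j. Poly_Mapping.single j 1) ` {j. j < m \<and> a j \<noteq> 0}"
proof
  fix \<mu> assume "\<mu> \<in> Poly_Mapping.keys (linear_form m a)"
  then have "\<mu> \<in> (\<Union>j\<in>{..<m}. Poly_Mapping.keys (Poly_Mapping.single (Poly_Mapping.single j 1) (a j)))"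
    unfolding linear_form_eq_sum_single by (rule subsetD[OF keys_sum])
  then obtain j where "j < m" "\<mu> \<in> Poly_Mapping.keys (Poly_Mapping.single (Poly_Mapping.single j 1) (a j))"
    by blast
  then show "\<mu> \<in> (\<lambda>j. Poly_Mapping.single j 1) ` {j. j < m \<and> a j \<noteq> 0}"
    by (auto split: if_splits)
qed

lemma linear_form_linear: "linear_form m a \<in> linear_forms {..<m}"
  using keys_linear_form[of m a] by (fastforce simp: linear_forms_def)

lemma vars_linear_form: "vars (linear_form m a) \<subseteq> {j. j < m \<and> a j \<noteq> 0}"
  using keys_linear_form[of m a] by (fastforce simp: vars_def split: if_splits)

lemma lookup_linear_form:
  "j < m \<Longrightarrow> Poly_Mapping.lookup (linear_form m a) (Poly_Mapping.single j 1) = a j"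
proof -
  assume j: "j < m"
  have inj: "Poly_Mapping.single i (1::nat) = Poly_Mapping.single j 1 \<longleftrightarrow> i = j" for i
    by (metis inj_single injD lookup_single_eq lookup_single_not_eq one_neq_zero)
  show ?thesis
    using j unfolding linear_form_eq_sum_single lookup_sum lookup_single when_def inj by simp
qed

lemma circuit_below:
  assumes "l \<in> L \<inter> linear_forms {..<m}" and "l \<noteq> 0"
  obtains g where "circuit m L g" and "vars g \<subseteq> vars l"
proof -
  let ?P = "\<lambda>g. g \<in> L \<inter> linear_forms {..<m} \<and> g \<noteq> 0 \<and> vars g \<subseteq> vars l"
  obtain g where g: "?P g" and least: "\<And>h. ?P h \<Longrightarrow> card (vars g) \<le> card (vars h)"
    using ex_has_least_nat[of ?P l "\<lambda>g. card (vars g)"] assms by auto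
  have "\<not> vars h \<subset> vars g" if "h \<in> L \<inter> linear_forms {..<m}" "h \<noteq> 0" for h
  proof
    assume sub: "vars h \<subset> vars g"
    then have "card (vars h) < card (vars g)"
      by (intro psubset_card_mono) (auto simp: vars_def)
    then show False
      using least[of h] sub g that by auto
  qed
  then show ?thesis
    using that[of g] g by (auto simp: circuit_def)
qed

context sparse_matrix
begin

text \<open>
  The support of a nonzero linear relation contains the support of a circuit, so it has at least three
  elements. In every row at most one of them carries a nonzero entry, so the minimum over the support is zero, and the
  division by \<open>X\<^sup>\<alpha>\<close> in the homogenized form is trivial.
\<close>

lemma twist_linear_form:
  assumes circuits: "\<And>l. circuit m L l \<Longrightarrow> 3 \<le> card (vars l)" and L: "linear_form m a \<in> L"
  shows "twist n D (linear_form m a) = homogenized_form n m D a"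
proof -
  have exponent: "a j = 0 \<or> (\<forall>i<n. min_exponent m D a i = 0)" if j: "j < m" for j
  proof (cases "a j = 0")
    case False
    then have "linear_form m a \<noteq> 0"
      using lookup_linear_form[OF j, of a] by auto
    then obtain g where "circuit m L g" "vars g \<subseteq> vars (linear_form m a)"
      using circuit_below[of "linear_form m a" L m] L linear_form_linear by blast
    then have "3 \<le> card (vars g)" "vars g \<subseteq> {j. j < m \<and> a j \<noteq> 0}"
      using circuits vars_linear_form[of m a] by auto
    moreover have "finite {j. j < m \<and> a j \<noteq> 0}"
      by simp
    ultimately have card: "3 \<le> card {j. j < m \<and> a j \<noteq> 0}"
      using card_mono le_trans by blast
    have "min_exponent m D a i = 0" if i: "i < n" for i
    proof -
      have "\<exists>j<m. a j \<noteq> 0 \<and> D i j = 0"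
      proof (rule ccontr)
        assume "\<not> ?thesis"
        then have "{j. j < m \<and> a j \<noteq> 0} \<subseteq> {j}"
          using sparse[OF i] j False by auto
        then show False
          using card card_mono[of "{j}" "{j. j < m \<and> a j \<noteq> 0}"] by simp
      qed
      then show ?thesis
        unfolding min_exponent_def using D_nonneg[OF i] by (intro Min_eqI) (auto simp: image_iff)
    qed
    then show ?thesis
      by blast
  qed simp
  have "twist n D (linear_form m a) = (\<Sum>j<m. Const (a j) * ((\<Prod>i<n. Var (Inl i) ^ nat (D i j)) * Var (Inr j)))"
    by (simp add: twist_def linear_form_def Const.eval_mpoly_sum Const.eval_mpoly_mult)
  also have "\<dots> = homogenized_form n m D a"
    unfolding homogenized_form_def
  proof (intro sum.cong refl)
    fix j assume "j \<in> {..<m}"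
    then show "Const (a j) * ((\<Prod>i<n. Var (Inl i) ^ nat (D i j)) * Var (Inr j)) =
        Const (a j) * (\<Prod>i<n. Var (Inl i) ^ nat (D i j - min_exponent m D a i)) * Var (Inr j)"
      using exponent[of j] by (auto simp: mult.assoc)
  qed
  finally show ?thesis .
qed

lemma twist_eq_homogenize: "g \<in> mpolys {..<m} \<Longrightarrow> twist n D g = homogenize n D (\<lambda>_. 0) g"
  using homogenize_nonpos[of n m D g "\<lambda>_. 0"] D_nonneg by simp

end

section \<open>Evaluating the valuation at points of the fan\<close>

lemma lattice_inner: "u \<in> lattice \<Longrightarrow> w \<in> lattice \<Longrightarrow> u \<bullet> w \<in> \<int>"
  unfolding lattice_def inner_vec_def by auto

lemma zero_in_fan: "fan \<Sigma> \<Longrightarrow> 0 \<in> \<Union>\<Sigma>"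
  unfolding fan_def strongly_convex_def by blast

lemma ray_in_cone:
  assumes "\<rho> \<in> ray_generators \<Sigma>"
  shows "convex_cone hull {\<rho>} \<in> \<Sigma>" and "\<rho> \<in> convex_cone hull {\<rho>}" and "\<rho> \<in> lattice"
  using assms by (auto simp: ray_generators_def primitive_def hull_inc)

lemma pl_valuation_value:
  assumes "pl_valuation \<Sigma> v" and "x \<in> \<Union>\<Sigma>" and "f \<noteq> 0"
  shows "\<exists>u\<in>lattice. v f x = ereal (u \<bullet> x)"
proof -
  have "v f \<in> pl_functions \<Sigma>"
    using assms(1,3) by (simp add: pl_valuation_def)
  then obtain \<Delta> where "\<Union>\<Delta> = \<Union>\<Sigma>" "\<forall>\<tau>\<in>\<Delta>. \<exists>u\<in>lattice. \<forall>x\<in>\<tau>. v f x = ereal (u \<bullet> x)"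
    unfolding pl_functions_def by blast
  then show ?thesis
    using assms(2) by blast
qed

lemma pl_valuation_integral:
  assumes "pl_valuation \<Sigma> v" and "x \<in> \<Union>\<Sigma>" and "x \<in> lattice" and "f \<noteq> 0"
  shows "\<exists>a. v f x = ereal (of_int a)"
  using pl_valuation_value[OF assms(1,2,4)] lattice_inner[OF _ assms(3)] by (metis Ints_cases)

lemma pl_valuation_point:
  assumes "pl_valuation \<Sigma> v" and "x \<in> \<Union>\<Sigma>"
  shows "point_valuation v x"
proof
  show "\<exists>a. v f x = ereal a" if "f \<noteq> 0" for f
    using pl_valuation_value[OF assms that] by blast
qed (use assms in \<open>auto simp: pl_valuation_def\<close>)

text \<open>
  At the origin every nonzero element has value zero, so that equality modulo larger values is equality,
  and generation of the associated graded algebra is generation of \<open>Sym(E)\<close>.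
\<close>

lemma khovanskii_basis_generates:
  fixes v :: "('r::finite, 'k::field) mpoly \<Rightarrow> real ^ 'N \<Rightarrow> ereal"
  assumes "fan \<Sigma>" and "pl_valuation \<Sigma> v" and "khovanskii_basis \<Sigma> v (b ` {..<m})"
  shows "\<exists>P\<in>mpolys {..<m}. f = eval_mpoly Const b P"
proof (cases "f = 0")
  case True
  then show ?thesis
    by (intro bexI[of _ 0]) auto
next
  case f: False
  have x: "0 \<in> \<Union>\<Sigma>"
    by (rule zero_in_fan[OF assms(1)])
  interpret point_valuation v 0
    by (rule pl_valuation_point[OF assms(2) x])
  have v0: "v g 0 = 0" if "g \<noteq> 0" for g
    using pl_valuation_value[OF assms(2) x that] by auto
  have closed: "p + q \<in> eval_mpoly Const b ` mpolys {..<m} \<and> p * q \<in> eval_mpoly Const b ` mpolys {..<m}"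
    if pq: "p \<in> eval_mpoly Const b ` mpolys {..<m}" "q \<in> eval_mpoly Const b ` mpolys {..<m}" for p q
  proof -
    obtain P Q where "P \<in> mpolys {..<m}" "Q \<in> mpolys {..<m}"
      "p = eval_mpoly Const b P" "q = eval_mpoly Const b Q"
      using pq by blast
    then have "p + q = eval_mpoly Const b (P + Q)" "p * q = eval_mpoly Const b (P * Q)"
      "P + Q \<in> mpolys {..<m}" "P * Q \<in> mpolys {..<m}"
      by (auto simp: Const.eval_mpoly_add Const.eval_mpoly_mult intro: mpolys_add mpolys_mult)
    then show ?thesis
      by blast
  qed
  have "\<exists>p\<in>eval_mpoly Const b ` mpolys {..<m}. ereal 0 < v (f - p) 0"
  proof (rule leading_part[where A = "\<lambda>_. eval_mpoly Const b ` mpolys {..<m}" and B = "b ` {..<m}"])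
    show "generate_ring (gr_algebra v 0) (gr_class v 0 ` (range Const \<union> b ` {..<m})) = carrier (gr_algebra v 0)"
      using assms(3) x unfolding khovanskii_basis_def by blast
    show "0 \<in> eval_mpoly Const b ` mpolys {..<m}"
      by (intro image_eqI[of _ _ 0]) auto
    show "Const c \<in> eval_mpoly Const b ` mpolys {..<m}" for c
      by (intro image_eqI[of _ _ "Const c"]) auto
    show "g \<in> eval_mpoly Const b ` mpolys {..<m}" if "g \<in> b ` {..<m}" for g
      using that by (auto intro!: image_eqI[of _ _ "Var _"] mpolys_Var)
    show "ereal 0 \<le> v f 0"
      using v0[OF f] by (simp add: zero_ereal_def)
  qed (use closed in blast)+
  then obtain P where "P \<in> mpolys {..<m}" "0 < v (f - eval_mpoly Const b P) 0"
    by (auto simp: zero_ereal_def)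
  then show ?thesis
    using v0[of "f - eval_mpoly Const b P"] by force
qed

section \<open>Sections and relations of a sparse bundle\<close>

lemma diagram_value:
  assumes "pl_valuation \<Sigma> v" and "\<rho> i \<in> \<Union>\<Sigma>" and "\<rho> i \<in> lattice" and "b j \<noteq> 0"
  shows "v (b j) (\<rho> i) = ereal (of_int (diagram v \<rho> b i j))"
  using pl_valuation_integral[OF assms] by (auto simp: diagram_def)

text \<open>
  By construction a monomial of degree \<open>r\<close> maps to a product of \<open>b\<close>'s of weight at least \<open>r\<close>: the weight minus the
  exponents of the \<open>X\<close>'s is \<open>r\<close>. Values of products are at least their weights, with equality only if no factor vanishes.
\<close>

lemma presentation_image_subset:
  fixes v :: "('r::finite, 'k::field) mpoly \<Rightarrow> real ^ 'N \<Rightarrow> ereal"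
  assumes val: "\<And>i. i < n \<Longrightarrow> point_valuation v (\<rho> i)"
    and v_b: "\<And>i j. i < n \<Longrightarrow> j < m \<Longrightarrow> ereal (of_int (D i j)) \<le> v (b j) (\<rho> i)"
    and F: "F \<in> mpolys (XY n m)"
  shows "presentation n D b F \<in> section_ring v n \<rho>"
proof -
  have keys: "Poly_Mapping.keys \<mu> \<subseteq> XY n m" if "\<mu> \<in> Poly_Mapping.keys F" for \<mu>
    using F that by (simp add: mpolys_iff)
  have ge: "ereal (of_int (Poly_Mapping.lookup r i)) \<le> v (Poly_Mapping.lookup (presentation n D b F) r) (\<rho> i)"
    if i: "i < n" for r i
  proof -
    interpret point_valuation v "\<rho> i" by (rule val[OF i])
    show ?thesis
      unfolding presentation_expand[OF F] lookup_sum lookup_single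
    proof (rule v_sum_ge)
      fix \<mu> assume \<mu>: "\<mu> \<in> Poly_Mapping.keys F"
      let ?t = "Const (Poly_Mapping.lookup F \<mu>) * eval_monom b (y_part \<mu>)"
      have "ereal (of_int (Poly_Mapping.lookup (total_degree n D \<mu>) i)) \<le> ereal (of_int (weight D (y_part \<mu>) i))"
        using i by (simp add: lookup_total_degree[OF keys[OF \<mu>]])
      also have "\<dots> \<le> v (eval_monom b (y_part \<mu>)) (\<rho> i)"
        using v_eval_monom_ge[of "y_part \<mu>" "\<lambda>j. of_int (D i j)" b] v_b[OF i] keys_y_part[OF keys[OF \<mu>]]
        by (auto simp: weight_def)
      also have "\<dots> = v ?t (\<rho> i)"
        using \<mu> by (simp add: v_mult in_keys_iff)
      finally show "ereal (of_int (Poly_Mapping.lookup r i)) \<le> v (?t when total_degree n D \<mu> = r) (\<rho> i)"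
        by (auto simp: when_def)
    qed
  qed
  have "Poly_Mapping.keys r \<subseteq> {..<n}" if r: "r \<in> Poly_Mapping.keys (presentation n D b F)" for r
  proof -
    have "r \<in> (\<Union>\<mu>\<in>Poly_Mapping.keys F. Poly_Mapping.keys (Poly_Mapping.single (total_degree n D \<mu>)
        (Const (Poly_Mapping.lookup F \<mu>) * eval_monom b (y_part \<mu>))))"
      using r unfolding presentation_expand[OF F] by (rule subsetD[OF keys_sum])
    then obtain \<mu> where "\<mu> \<in> Poly_Mapping.keys F" "r = total_degree n D \<mu>"
      by (auto split: if_splits)
    then show ?thesis
      by (auto simp: in_keys_iff lookup_total_degree[OF keys] split: if_splits)
  qed
  with ge show ?thesis
    by (auto simp: section_ring_def)
qed

theorem corollary6p7:
  fixes \<Sigma> :: "(real ^ 'N) set set"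
    and v :: "('r::finite, 'k::alg_closed_field) mpoly \<Rightarrow> real ^ 'N \<Rightarrow> ereal"
    and n m d :: nat
    and \<rho> :: "nat \<Rightarrow> real ^ 'N"
    and b :: "nat \<Rightarrow> ('r, 'k) mpoly"
    and c :: "nat \<Rightarrow> nat \<Rightarrow> 'k"
  assumes "smooth_fan \<Sigma>"
    and "bij_betw \<rho> {..<n} (ray_generators \<Sigma>)"
    and "toric_vector_bundle \<Sigma> v"
    and "inj_on b {..<m}"
    and "khovanskii_basis \<Sigma> v (b ` {..<m})"
    and "normalized_diagram n m (diagram v \<rho> b)"
    and "sparse_diagram n m (diagram v \<rho> b)"
    and "minimal_generators m (relation_ideal m b) d (\<lambda>k. linear_form m (c k))"
    and "\<And>l. circuit m (relation_ideal m b) l \<Longrightarrow> 3 \<le> card (vars l)"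
  shows "Phi v n \<rho> b ` mpolys (XY n m) = section_ring v n \<rho> \<and>
         {f \<in> mpolys (XY n m). Phi v n \<rho> b f = 0} =
         ideal_gen (XY n m) ((\<lambda>k. homogenized_form n m (diagram v \<rho> b) (c k)) ` {..<d})"
proof -
  define D where "D = diagram v \<rho> b"
  let ?l = "\<lambda>k. linear_form m (c k)" and ?p = "\<lambda>k. homogenized_form n m D (c k)"
  let ?Phi = "presentation n D b" and ?P = "(\<lambda>k. homogenized_form n m D (c k)) ` {..<d}"
  have fan: "fan \<Sigma>"
    using assms(1) by (simp add: smooth_fan_def)
  have pl: "pl_valuation \<Sigma> v"
    using assms(3) by (simp add: toric_vector_bundle_def)
  have ray: "\<rho> i \<in> ray_generators \<Sigma>" if "i < n" for i
    using assms(2) that by (auto simp: bij_betw_def)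
  have support: "\<rho> i \<in> \<Union>\<Sigma>" if "i < n" for i
    using ray_in_cone(1,2)[OF ray[OF that]] by blast
  have val: "point_valuation v (\<rho> i)" if "i < n" for i
    using pl_valuation_point[OF pl support[OF that]] .
  have v_b: "v (b j) (\<rho> i) = ereal (of_int (D i j))" if "i < n" "b j \<noteq> 0" for i j
    unfolding D_def by (rule diagram_value[OF pl support ray_in_cone(3)[OF ray]]) (rule that)+
  \<comment> \<open>The value of a zero \<open>b j\<close> is infinite, and its entry in the diagram is zero by the convention for \<open>real_of_ereal\<close>.\<close>
  have D_zero: "D i j = 0" if "i < n" "b j = 0" for i j
    using point_valuation.v_zero[OF val[OF that(1)]] that(2) by (simp add: D_def diagram_def)
  have D_le: "ereal (of_int (D i j)) \<le> v (b j) (\<rho> i)" if "i < n" for i j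
    using v_b[OF that] point_valuation.v_zero[OF val[OF that]] by (cases "b j = 0") auto
  have D_nonneg: "0 \<le> D i j" if "i < n" "j < m" for i j
    using assms(6) that by (simp add: normalized_diagram_def D_def)
  interpret sparse_matrix n m D
  proof
    fix i j j' assume "i < n" "j < m" "j' < m" "D i j \<noteq> 0" "D i j' \<noteq> 0"
    then have "card {j. j < m \<and> D i j \<noteq> 0} \<le> 1" "{j, j'} \<subseteq> {j. j < m \<and> D i j \<noteq> 0}"
      using assms(7) by (auto simp: sparse_diagram_def D_def)
    then have "card {j, j'} \<le> 1"
      using card_mono[of "{j. j < m \<and> D i j \<noteq> 0}" "{j, j'}"] by simp
    then show "j = j'"
      by (cases "j = j'") auto
  qed (rule D_nonneg)
  \<comment> \<open>The linear form \<open>q\<close> of \<open>ray_divisor\<close> is the element of the only nonzero entry of the row, and zero for a zero row.\<close>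
  have divisor: "\<exists>j<m. D i j \<noteq> 0 \<and> b j dvd f" if i: "i < n" and f: "0 < v f (\<rho> i)" "f \<noteq> 0" for i f
  proof -
    interpret point_valuation v "\<rho> i" by (rule val[OF i])
    let ?\<sigma> = "convex_cone hull {\<rho> i}"
    obtain \<beta> where \<beta>: "adapted_basis v ?\<sigma> \<beta>"
      using assms(3) ray_in_cone(1)[OF ray[OF i]] by (auto simp: toric_vector_bundle_def)
    have gen: "generate_ring (gr_algebra v (\<rho> i)) (gr_class v (\<rho> i) ` (range Const \<union> b ` {..<m})) =
        carrier (gr_algebra v (\<rho> i))"
      using assms(5) support[OF i] unfolding khovanskii_basis_def by blast
    have int: "\<exists>a. v f (\<rho> i) = ereal (of_int a)" if "f \<noteq> 0" for f
      using pl_valuation_integral[OF pl support[OF i] ray_in_cone(3)[OF ray[OF i]] that] .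
    have nonneg: "0 \<le> v g (\<rho> i)" if "g \<in> b ` {..<m}" for g
      using that D_nonneg[OF i] order_trans[OF _ D_le[OF i]] by (auto simp: zero_ereal_def)
    note divides = dvd_of_v_pos[OF gen \<beta> ray_in_cone(2)[OF ray[OF i]] int _ nonneg _ f(1)]
    have pos: "D i j \<noteq> 0" if "j < m" "b j \<noteq> 0" "0 < v (b j) (\<rho> i)" for j
      using that v_b[OF i that(2)] by auto
    show ?thesis
    proof (cases "\<exists>j<m. D i j \<noteq> 0")
      case True
      then obtain j where j: "j < m" "D i j \<noteq> 0"
        by blast
      have "b j \<in> fiber"
        using assms(5) j(1) by (auto simp: khovanskii_basis_def)
      moreover have "b j dvd g" if g: "g \<in> b ` {..<m}" "0 < v g (\<rho> i)" for g
      proof -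
        obtain j' where j': "j' < m" "g = b j'"
          using g(1) by auto
        show ?thesis
          using pos[OF j'(1)] sparse[OF i j(1) j'(1) j(2)] g(2) j'(2) by (cases "g = 0") auto
      qed
      ultimately show ?thesis
        using divides[of "b j"] j by blast
    next
      case False
      have "0 dvd g" if g: "g \<in> b ` {..<m}" "0 < v g (\<rho> i)" for g
        using g pos False by auto
      moreover have "(0 :: ('r, 'k) mpoly) \<in> fiber"
        by (simp add: linear_forms_def)
      ultimately show ?thesis
        using divides[of 0] f(2) by simp
    qed
  qed
  have sections: "?Phi ` mpolys (XY n m) = section_ring v n \<rho>"
  proof
    show "?Phi ` mpolys (XY n m) \<subseteq> section_ring v n \<rho>"
      using presentation_image_subset[of n v \<rho> m D b, OF val D_le] by blast
    show "section_ring v n \<rho> \<subseteq> ?Phi ` mpolys (XY n m)"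
    proof
      fix F assume F: "F \<in> section_ring v n \<rho>"
      have "\<exists>G\<in>mpolys (XY n m). Poly_Mapping.single r (Poly_Mapping.lookup F r) = ?Phi G"
        if r: "r \<in> Poly_Mapping.keys F" for r
      proof -
        have "ereal (of_int (Poly_Mapping.lookup r i)) \<le> v (Poly_Mapping.lookup F r) (\<rho> i)" if "i < n" for i
          using F r that by (auto simp: section_ring_def)
        then obtain P where P: "P \<in> mpolys {..<m}" "Poly_Mapping.lookup F r = eval_mpoly Const b P"
          "\<forall>\<beta>\<in>Poly_Mapping.keys P. \<forall>i<n. Poly_Mapping.lookup r i \<le> weight D \<beta> i"
          using representation_of_bounded_values[OF val khovanskii_basis_generates[OF fan pl assms(5)] v_b divisor]
          by blast
        then show ?thesis
          using F r presentation_homogenize[OF P(1), of r n D b]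
          by (intro bexI[of _ "homogenize n D (Poly_Mapping.lookup r) P"] homogenize_mpolys)
            (auto simp: section_ring_def)
      qed
      then obtain G where G: "\<And>r. r \<in> Poly_Mapping.keys F \<Longrightarrow> G r \<in> mpolys (XY n m)"
        "\<And>r. r \<in> Poly_Mapping.keys F \<Longrightarrow> Poly_Mapping.single r (Poly_Mapping.lookup F r) = ?Phi (G r)"
        by metis
      have "F = (\<Sum>r\<in>Poly_Mapping.keys F. ?Phi (G r))"
        by (subst poly_mapping_sum_single) (simp add: G(2))
      also have "\<dots> = ?Phi (\<Sum>r\<in>Poly_Mapping.keys F. G r)"
        unfolding presentation_def by (simp add: single_Const.eval_mpoly_sum)
      finally show "F \<in> ?Phi ` mpolys (XY n m)"
        using G(1) by (auto intro: mpolys_sum)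
    qed
  qed
  have generators: "ideal_gen {..<m} (?l ` {..<d}) = relation_ideal m b"
    using assms(8) by (simp add: minimal_generators_def)
  have l_rel: "?l k \<in> relation_ideal m b" if "k < d" for k
    unfolding generators[symmetric] using that by (intro ideal_gen_incl) auto
  have twist_l: "twist n D (?l k) = ?p k" if "k < d" for k
    using twist_linear_form[OF assms(9) l_rel[OF that]] .
  have twist_mem: "twist n D g \<in> ideal_gen (XY n m) ?P" if g: "g \<in> relation_ideal m b" for g
  proof -
    obtain q where q: "g = (\<Sum>x\<in>?l ` {..<d}. q x * x)" "\<forall>x\<in>?l ` {..<d}. q x \<in> mpolys {..<m}"
      using g unfolding generators[symmetric] ideal_gen_def by blast
    have "twist n D (q x) * twist n D x \<in> ideal_gen (XY n m) ?P" if "x \<in> ?l ` {..<d}" for x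
      using that q(2) twist_l by (intro ideal_gen_mult twist_mpolys ideal_gen_incl) auto
    then show ?thesis
      unfolding q(1) by (simp add: twist_def Const.eval_mpoly_sum Const.eval_mpoly_mult
          sum_mem_closed ideal_gen_zero ideal_gen_add)
  qed
  have domain: "f = 0 \<or> g = 0" if "f * g = 0" for f g :: "('r, 'k) mpoly"
    using point_valuation.mult_eq_zero_iff[OF pl_valuation_point[OF pl zero_in_fan[OF fan]]] that by blast
  have b_nonzero: "b j \<noteq> 0" if "i < n" "j < m" "D i j \<noteq> 0" for i j
    using D_zero that by blast
  have Phi_p: "?Phi (?p k) = 0" if k: "k < d" for k
  proof -
    have l: "?l k \<in> mpolys {..<m}" "eval_mpoly Const b (?l k) = 0"
      using l_rel[OF k] by (auto simp: relation_ideal_def)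
    have "?Phi (homogenize n D (Poly_Mapping.lookup 0) (?l k)) = Poly_Mapping.single 0 (eval_mpoly Const b (?l k))"
      using l(1) weight_nonneg by (intro presentation_homogenize) (auto simp: mpolys_iff)
    moreover have "?p k = homogenize n D (Poly_Mapping.lookup 0) (?l k)"
      using twist_l[OF k] twist_eq_homogenize[OF l(1)] by (simp add: zero_poly_mapping.rep_eq)
    ultimately show ?thesis
      by (simp add: l(2))
  qed
  have "{F \<in> mpolys (XY n m). ?Phi F = 0} = ideal_gen (XY n m) ?P"
  proof
    show "{F \<in> mpolys (XY n m). ?Phi F = 0} \<subseteq> ideal_gen (XY n m) ?P"
    proof
      fix F assume F: "F \<in> {F \<in> mpolys (XY n m). ?Phi F = 0}"
      show "F \<in> ideal_gen (XY n m) ?P"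
      proof (rule kernel_subset_ideal)
        fix g r assume g: "g \<in> relation_ideal m b"
          and le: "\<And>\<beta> i. \<beta> \<in> Poly_Mapping.keys g \<Longrightarrow> i < n \<Longrightarrow> r i \<le> weight D \<beta> i"
        show "homogenize n D r g \<in> ideal_gen (XY n m) ?P"
        proof (rule homogenize_relation[of b, OF _ domain b_nonzero g le])
          show "twist n D g \<in> ideal_gen (XY n m) ?P" if "g \<in> relation_ideal m b" for g
            by (rule twist_mem[OF that])
        qed
      qed (use F in auto)
    qed
    show "ideal_gen (XY n m) ?P \<subseteq> {F \<in> mpolys (XY n m). ?Phi F = 0}"
    proof
      fix F assume "F \<in> ideal_gen (XY n m) ?P"
      then obtain q where q: "F = (\<Sum>g\<in>?P. q g * g)" "\<forall>g\<in>?P. q g \<in> mpolys (XY n m)"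
        unfolding ideal_gen_def by blast
      have "g \<in> mpolys (XY n m)" if "g \<in> ?P" for g
      proof -
        obtain k where "k < d" "g = twist n D (?l k)"
          using \<open>g \<in> ?P\<close> twist_l by auto
        then show ?thesis
          using l_rel[of k] by (auto simp: relation_ideal_def intro: twist_mpolys)
      qed
      then have "F \<in> mpolys (XY n m)"
        unfolding q(1) using q(2) by (intro mpolys_sum mpolys_mult) auto
      moreover have "?Phi F = (\<Sum>g\<in>?P. ?Phi (q g) * ?Phi g)"
        by (simp add: q(1) presentation_def single_Const.eval_mpoly_sum single_Const.eval_mpoly_mult)
      then have "?Phi F = 0"
        using Phi_p by (auto intro!: sum.neutral)
      ultimately show "F \<in> {F \<in> mpolys (XY n m). ?Phi F = 0}"
        by simp
    qed
  qed
  with sections show ?thesis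
    by (simp add: Phi_eq_presentation D_def)
qed

end
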